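(* The bounded adaptation problem and the eventual adaptation problem are both undecidable in $\mathcal{E}_s^1$.
   Context: Fix a countably infinite set $\mathcal N$ of names $a,b,\dots$. Syntax. Prefixes are $\pi ::= a \mid \overline{a} \mid \widetilde{a}\{U\}$ (input, output, update prefix), where $U$ is an update pattern. Processes: $P ::= a[P] \mid P\parallel P \mid \sum_{i\in I}\pi_i.P_i \mid\ !\pi.P$ with $I$ finite ($\mathbf 0$ is the empty sum; $a[P]$ is the adaptable process $P$ located at $a$). Update patterns are terms of the same grammar extended with a hole $\bullet$: $U ::= \bullet \mid a[U]\mid U\parallel U\mid \sum_{i\in I}\pi_i.U_i\mid\ !\pi.U$. For a pattern $U$ and a process $Q$, $U\{Q\}$ is given by $\bullet\{Q\}=Q$, $a[U]\{Q\}=a[U\{Q\}]$, $(U_1\parallel U_2)\{Q\}=U_1\{Q\}\parallel U_2\{Q\}$, $(\sum_i\pi_i.U_i)\{Q\}=\sum_i\pi_i.(U_i\{Q\})$, $(!\pi.U)\{Q\}=!\pi.(U\{Q\})$ (holes inside update prefixes are not filled). $\prod^k P$ denotes $k$ parallel copies of $P$. Static processes $\mathcal E_s$: generated by $P::=a[P]\mid P\parallel P\mid A$, $A ::= A\parallel A\mid\ !\pi.A\mid \sum_{i\in I}\pi_i.A_i$, $\pi::= a\mid\overline a\mid \widetilde a\{a[U]\parallel A\}$, where $U$ ranges over patterns generated by this grammar with $\bullet$ added to both categories $P$ and $A$. Family restriction 1: none; so $\mathcal E_s^1=\mathcal E_s$. Auxiliary functions on patterns: $\mathrm{numap}(\bullet)=0$,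 $\mathrm{numap}(a[U])=1+\mathrm{numap}(U)$, $\mathrm{numap}(U_1\parallel U_2)=\mathrm{numap}(U_1)+\mathrm{numap}(U_2)$, $\mathrm{numap}(\sum_i\pi_i.U_i)=\mathrm{numap}(!\pi.U)=0$. $\mathrm{numholes}(\bullet)=1$, $\mathrm{numholes}(a[U])=\mathrm{numholes}(U)$, additive on $\parallel$, $\mathrm{numholes}(\sum_i\pi_i.U_i)=\sum_i\mathrm{numholes}(U_i)$, $\mathrm{numholes}(!\pi.U)=\mathrm{numholes}(U)$. $\mathrm{numph}(\bullet)=0$, $\mathrm{numph}(a[U])=\mathrm{numph}(U)$, additive on $\parallel$, $\mathrm{numph}(\sum_i\pi_i.U_i)=\sum_i\mathrm{numholes}(U_i)$, $\mathrm{numph}(!\pi.U)=\mathrm{numholes}(U)$. Every process is, up to commutativity/associativity of $\parallel$, of the form $\prod_{i=1}^m P_i\parallel\prod_{j=1}^n a_j[P'_j]$ with each $P_i$ neither a parallel composition nor located and each $P'_j$ of this form; its containment structure $\mathrm{CStr}$ is the unordered rooted tree with root labelled $\epsilon$ whose children are the roots of $\mathrm{CStr}(P'_1),\dots,\mathrm{CStr}(P'_n)$ relabelled $a_1,\dots,a_n$. Semantics. Labels $\alpha::= a\mid\overline a\mid a[P]\mid\widetilde a\{U\}\mid\tau$; $\star$ is a fresh placeholder. Rules: $a[P]\xrightarrow{a[P]}\star$; $\sum_{i\in I}\pi_i.P_i\xrightarrow{\pi_j}P_j$ ($j\in I$); $!\pi.P\xrightarrow{\pi}P\parallel!\pi.P$;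 if $P\xrightarrow\alpha P'$ then $a[P]\xrightarrow\alpha a[P']$; if $P_1\xrightarrow\alpha P_1'$ then $P_1\parallel P_2\xrightarrow\alpha P_1'\parallel P_2$ and $P_2\parallel P_1\xrightarrow\alpha P_2\parallel P_1'$; if $P_1\xrightarrow{a} P_1'$ and $P_2\xrightarrow{\overline a}P_2'$ then $P_1\parallel P_2\xrightarrow\tau P_1'\parallel P_2'$ and $P_2\parallel P_1\xrightarrow\tau P_2'\parallel P_1'$; if $P_1\xrightarrow{a[Q]}P_1'$, $P_2\xrightarrow{\widetilde a\{U\}}P_2'$ and $\mathsf{cond}(U,Q)$ then $P_1\parallel P_2\xrightarrow\tau P_1'[U\{Q\}/\star]\parallel P_2'$ and $P_2\parallel P_1\xrightarrow\tau P_2'\parallel P_1'[U\{Q\}/\star]$. For the static LTS $\to_s$, $\mathsf{cond}(U,Q)$ holds iff $U=a[U']\parallel A$ with $\mathrm{CStr}(a[Q])=\mathrm{CStr}(a[U'\{Q\}]\parallel A)$ and ($\mathrm{numph}(U)>0\Rightarrow\mathrm{numap}(Q)=0$). A reduction $P\to P'$ is $P\xrightarrow\tau P'$; $\to^*$ is its reflexive–transitive closure. Barbs and problems. For $\alpha\in\{a,\overline a\}$, $P\downarrow_\alpha$ iff $P\xrightarrow\alpha P'$ for some $P'$. For $k\ge1$, $P\Downarrow^k_\alpha$ iff there exist $Q_1,\dots,Q_k$ with $P\to^*Q_1\to Q_2\to\cdots\to Q_k$ and $Q_i\downarrow_\alpha$ for all $i$; $P\Downarrow^\omega_\alpha$ iff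 there is an infinite computation $P\to^*Q_1\to Q_2\to\cdots$ with $Q_i\downarrow_\alpha$ for all $i\ge1$. For a process $P$ and finite set $M=\{P_1,\dots,P_n\}$, $\mathcal{BC}^M_P=\{P\parallel\prod^{m_1}P_1\parallel\cdots\parallel\prod^{m_n}P_n\mid m_1,\dots,m_n\in\mathbb N\}$. Bounded adaptation: given $P$, finite $M$, a barb $e$ and $k\ge1$, decide whether no $R\in\mathcal{BC}^M_P$ satisfies $R\Downarrow^k_e$. Eventual adaptation: given $P$, $M$, $e$, decide whether no $R\in\mathcal{BC}^M_P$ satisfies $R\Downarrow^\omega_e$. Decidability "in a class" means $P$ and $M$ range over processes of that class, with that class's transition relation. *)

theory Defs
  imports Complex_Main "HOL-Library.Multiset" "HOL-Library.Nat_Bijection"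
begin

section \<open>Syntax\<close>

type_synonym name = nat

text \<open>
  Processes, update patterns and the derivatives of the transition relation are all terms of one
  type. A process has no \<open>Star\<close>, and has \<open>Hole\<close> only inside update prefixes; an update pattern
  has no \<open>Star\<close>. The constructor \<open>Star\<close> is the placeholder left behind by a
  transition that emits a located process. A finite sum is given by the list of its summands, and
  \<open>Choice []\<close> is the inactive process.
\<close>

datatype prefix = In name | Out name | Upd name trm
and trm =
    Hole
  | Star
  | Loc name trm
  | Par trm trm
  | Choice "(prefix \<times> trm) list"
  | Rep prefix trm

abbreviation Nil_proc :: trm where "Nil_proc \<equiv> Choice []"

fun fill :: "trm \<Rightarrow> trm \<Rightarrow> trm" where
  "fill Hole Q = Q"
| "fill Star Q = Star"
| "fill (Loc a U) Q = Loc a (fill U Q)"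
| "fill (Par U V) Q = Par (fill U Q) (fill V Q)"
| "fill (Choice xs) Q = Choice (map (\<lambda>(\<pi>, U). (\<pi>, fill U Q)) xs)"
| "fill (Rep \<pi> U) Q = Rep \<pi> (fill U Q)"

fun subst_star :: "trm \<Rightarrow> trm \<Rightarrow> trm" where
  "subst_star Hole R = Hole"
| "subst_star Star R = R"
| "subst_star (Loc a P) R = Loc a (subst_star P R)"
| "subst_star (Par P Q) R = Par (subst_star P R) (subst_star Q R)"
| "subst_star (Choice xs) R = Choice (map (\<lambda>(\<pi>, P). (\<pi>, subst_star P R)) xs)"
| "subst_star (Rep \<pi> P) R = Rep \<pi> (subst_star P R)"

fun copies :: "nat \<Rightarrow> trm \<Rightarrow> trm" where
  "copies 0 P = Nil_proc"
| "copies (Suc 0) P = P"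
| "copies (Suc (Suc n)) P = Par P (copies (Suc n) P)"


section \<open>Static processes\<close>

text \<open>
  \<open>static_pattern\<close> and \<open>static_act_pattern\<close> are \<open>static_proc\<close> and \<open>static_act\<close> with the hole
  added. In an update prefix \<open>Upd a (Par (Loc a U) A)\<close> only \<open>U\<close> is a pattern; \<open>A\<close> has no hole
  of its own.
\<close>

inductive static_proc :: "trm \<Rightarrow> bool"
  and static_act :: "trm \<Rightarrow> bool"
  and static_prefix :: "prefix \<Rightarrow> bool"
  and static_pattern :: "trm \<Rightarrow> bool"
  and static_act_pattern :: "trm \<Rightarrow> bool"
where
  "static_proc P \<Longrightarrow> static_proc (Loc a P)"
| "static_proc P \<Longrightarrow> static_proc Q \<Longrightarrow> static_proc (Par P Q)"
| "static_act A \<Longrightarrow> static_proc A"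
| "static_act A \<Longrightarrow> static_act B \<Longrightarrow> static_act (Par A B)"
| "static_prefix \<pi> \<Longrightarrow> static_act A \<Longrightarrow> static_act (Rep \<pi> A)"
| "\<forall>(\<pi>, A) \<in> set xs. static_prefix \<pi> \<and> static_act A \<Longrightarrow> static_act (Choice xs)"
| "static_prefix (In a)"
| "static_prefix (Out a)"
| "static_pattern U \<Longrightarrow> static_act A \<Longrightarrow> static_prefix (Upd a (Par (Loc a U) A))"
| "static_pattern Hole"
| "static_pattern U \<Longrightarrow> static_pattern (Loc a U)"
| "static_pattern U \<Longrightarrow> static_pattern V \<Longrightarrow> static_pattern (Par U V)"
| "static_act_pattern A \<Longrightarrow> static_pattern A"
| "static_act_pattern Hole"
| "static_act_pattern A \<Longrightarrow> static_act_pattern B \<Longrightarrow> static_act_pattern (Par A B)"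
| "static_prefix \<pi> \<Longrightarrow> static_act_pattern A \<Longrightarrow> static_act_pattern (Rep \<pi> A)"
| "\<forall>(\<pi>, A) \<in> set xs. static_prefix \<pi> \<and> static_act_pattern A \<Longrightarrow> static_act_pattern (Choice xs)"

definition Es :: "trm set" where
  "Es = {P. static_proc P}"

text \<open>The first family imposes no restriction on update patterns.\<close>

definition Es1 :: "trm set" where
  "Es1 = Es"


section \<open>Semantics\<close>

fun numap :: "trm \<Rightarrow> nat" where
  "numap Hole = 0"
| "numap Star = 0"
| "numap (Loc a U) = 1 + numap U"
| "numap (Par U V) = numap U + numap V"
| "numap (Choice xs) = 0"
| "numap (Rep \<pi> U) = 0"

fun numholes :: "trm \<Rightarrow> nat" where
  "numholes Hole = 1"
| "numholes Star = 0"
| "numholes (Loc a U) = numholes U"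
| "numholes (Par U V) = numholes U + numholes V"
| "numholes (Choice xs) = sum_list (map (\<lambda>(\<pi>, U). numholes U) xs)"
| "numholes (Rep \<pi> U) = numholes U"

fun numph :: "trm \<Rightarrow> nat" where
  "numph Hole = 0"
| "numph Star = 0"
| "numph (Loc a U) = numph U"
| "numph (Par U V) = numph U + numph V"
| "numph (Choice xs) = sum_list (map (\<lambda>(\<pi>, U). numholes U) xs)"
| "numph (Rep \<pi> U) = numholes U"

text \<open>Unordered rooted trees; the label \<open>None\<close> is \<open>\<epsilon>\<close>.\<close>

datatype ctree = CNode "name option" "ctree multiset"

fun cchildren :: "trm \<Rightarrow> ctree multiset" where
  "cchildren (Loc a P) = {#CNode (Some a) (cchildren P)#}"
| "cchildren (Par P Q) = cchildren P + cchildren Q"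
| "cchildren _ = {#}"

definition CStr :: "trm \<Rightarrow> ctree" where
  "CStr P = CNode None (cchildren P)"

definition static_cond :: "name \<Rightarrow> trm \<Rightarrow> trm \<Rightarrow> bool" where
  "static_cond a U Q \<longleftrightarrow>
     (\<exists>U' A. U = Par (Loc a U') A \<and> CStr (Loc a Q) = CStr (Par (Loc a (fill U' Q)) A)) \<and>
     (numph U > 0 \<longrightarrow> numap Q = 0)"

datatype label = LIn name | LOut name | LLoc name trm | LUpd name trm | LTau

fun label_of :: "prefix \<Rightarrow> label" where
  "label_of (In a) = LIn a"
| "label_of (Out a) = LOut a"
| "label_of (Upd a U) = LUpd a U"

inductive static_trans :: "trm \<Rightarrow> label \<Rightarrow> trm \<Rightarrow> bool" where
  "static_trans (Loc a P) (LLoc a P) Star"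
| "(\<pi>, P) \<in> set xs \<Longrightarrow> static_trans (Choice xs) (label_of \<pi>) P"
| "static_trans (Rep \<pi> P) (label_of \<pi>) (Par P (Rep \<pi> P))"
| "static_trans P \<alpha> P' \<Longrightarrow> static_trans (Loc a P) \<alpha> (Loc a P')"
| "static_trans P \<alpha> P' \<Longrightarrow> static_trans (Par P Q) \<alpha> (Par P' Q)"
| "static_trans P \<alpha> P' \<Longrightarrow> static_trans (Par Q P) \<alpha> (Par Q P')"
| "static_trans P (LIn a) P' \<Longrightarrow> static_trans Q (LOut a) Q' \<Longrightarrow>
     static_trans (Par P Q) LTau (Par P' Q')"
| "static_trans P (LIn a) P' \<Longrightarrow> static_trans Q (LOut a) Q' \<Longrightarrow>
     static_trans (Par Q P) LTau (Par Q' P')"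
| "static_trans P (LLoc a R) P' \<Longrightarrow> static_trans Q (LUpd a U) Q' \<Longrightarrow> static_cond a U R \<Longrightarrow>
     static_trans (Par P Q) LTau (Par (subst_star P' (fill U R)) Q')"
| "static_trans P (LLoc a R) P' \<Longrightarrow> static_trans Q (LUpd a U) Q' \<Longrightarrow> static_cond a U R \<Longrightarrow>
     static_trans (Par Q P) LTau (Par Q' (subst_star P' (fill U R)))"

definition static_red :: "trm \<Rightarrow> trm \<Rightarrow> bool" where
  "static_red P P' \<longleftrightarrow> static_trans P LTau P'"


section \<open>Barbs and the adaptation problems\<close>

datatype barb = BIn name | BOut name

fun label_of_barb :: "barb \<Rightarrow> label" where
  "label_of_barb (BIn a) = LIn a"
| "label_of_barb (BOut a) = LOut a"

definition has_barb :: "trm \<Rightarrow> barb \<Rightarrow> bool" where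
  "has_barb P e \<longleftrightarrow> (\<exists>P'. static_trans P (label_of_barb e) P')"

definition barb_k :: "nat \<Rightarrow> trm \<Rightarrow> barb \<Rightarrow> bool" where
  "barb_k k P e \<longleftrightarrow>
     (\<exists>Q :: nat \<Rightarrow> trm. static_red\<^sup>*\<^sup>* P (Q 1) \<and>
        (\<forall>i. 1 \<le> i \<and> i < k \<longrightarrow> static_red (Q i) (Q (i + 1))) \<and>
        (\<forall>i. 1 \<le> i \<and> i \<le> k \<longrightarrow> has_barb (Q i) e))"

definition barb_omega :: "trm \<Rightarrow> barb \<Rightarrow> bool" where
  "barb_omega P e \<longleftrightarrow>
     (\<exists>Q :: nat \<Rightarrow> trm. static_red\<^sup>*\<^sup>* P (Q 1) \<and>
        (\<forall>i\<ge>1. static_red (Q i) (Q (i + 1))) \<and>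
        (\<forall>i\<ge>1. has_barb (Q i) e))"

text \<open>The finite set \<open>M\<close> is given by a list that enumerates it without repetition.\<close>

definition BC :: "trm \<Rightarrow> trm list \<Rightarrow> trm set" where
  "BC P M = {foldl Par P (map2 copies ms M) | ms. length ms = length M}"

definition bounded_instances :: "trm set \<Rightarrow> (trm \<times> trm list \<times> barb \<times> nat) set" where
  "bounded_instances C = {(P, M, e, k). P \<in> C \<and> set M \<subseteq> C \<and> distinct M \<and> k \<ge> 1}"

fun bounded_adaptation :: "trm \<times> trm list \<times> barb \<times> nat \<Rightarrow> bool" where
  "bounded_adaptation (P, M, e, k) \<longleftrightarrow> \<not> (\<exists>R \<in> BC P M. barb_k k R e)"

definition eventual_instances :: "trm set \<Rightarrow> (trm \<times> trm list \<times> barb) set" where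
  "eventual_instances C = {(P, M, e). P \<in> C \<and> set M \<subseteq> C \<and> distinct M}"

fun eventual_adaptation :: "trm \<times> trm list \<times> barb \<Rightarrow> bool" where
  "eventual_adaptation (P, M, e) \<longleftrightarrow> \<not> (\<exists>R \<in> BC P M. barb_omega R e)"


section \<open>Decidability\<close>

text \<open>
  The partial recursive functions: \<open>rec_eval f xs y\<close> says that \<open>f\<close> is defined on the arguments
  \<open>xs\<close> with value \<open>y\<close>. \<open>Prim\<close> recurses on, and \<open>Mu\<close> searches over, the first argument.
\<close>

datatype recf = Zero | Succ | Proj nat | Comp recf "recf list" | Prim recf recf | Mu recf

inductive rec_eval :: "recf \<Rightarrow> nat list \<Rightarrow> nat \<Rightarrow> bool" where
  "rec_eval Zero xs 0"
| "rec_eval Succ [x] (Suc x)"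
| "i < length xs \<Longrightarrow> rec_eval (Proj i) xs (xs ! i)"
| "list_all2 (\<lambda>g y. rec_eval g xs y) gs ys \<Longrightarrow> rec_eval f ys z \<Longrightarrow> rec_eval (Comp f gs) xs z"
| "rec_eval f xs y \<Longrightarrow> rec_eval (Prim f g) (0 # xs) y"
| "rec_eval (Prim f g) (n # xs) r \<Longrightarrow> rec_eval g (n # r # xs) y \<Longrightarrow>
     rec_eval (Prim f g) (Suc n # xs) y"
| "rec_eval f (n # xs) 0 \<Longrightarrow> \<forall>i<n. \<exists>y. rec_eval f (i # xs) (Suc y) \<Longrightarrow> rec_eval (Mu f) xs n"

text \<open>
  A problem with instances \<open>I\<close>, coded as numbers by \<open>code\<close>, is decidable if some partial recursive
  function is defined on the codes of all instances and computes there the characteristic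
  function of the yes-instances. Its behaviour on other numbers is irrelevant.
\<close>

definition decidable_problem :: "('i \<Rightarrow> nat) \<Rightarrow> 'i set \<Rightarrow> ('i \<Rightarrow> bool) \<Rightarrow> bool" where
  "decidable_problem code I yes \<longleftrightarrow>
     (\<exists>f. \<forall>x\<in>I. rec_eval f [code x] (if yes x then 1 else 0))"

fun code_prefix :: "prefix \<Rightarrow> nat" and code_trm :: "trm \<Rightarrow> nat" where
  "code_prefix (In a) = prod_encode (0, a)"
| "code_prefix (Out a) = prod_encode (1, a)"
| "code_prefix (Upd a U) = prod_encode (2, prod_encode (a, code_trm U))"
| "code_trm Hole = prod_encode (0, 0)"
| "code_trm Star = prod_encode (1, 0)"
| "code_trm (Loc a P) = prod_encode (2, prod_encode (a, code_trm P))"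
| "code_trm (Par P Q) = prod_encode (3, prod_encode (code_trm P, code_trm Q))"
| "code_trm (Choice xs) =
     prod_encode (4, list_encode (map (\<lambda>(\<pi>, P). prod_encode (code_prefix \<pi>, code_trm P)) xs))"
| "code_trm (Rep \<pi> P) = prod_encode (5, prod_encode (code_prefix \<pi>, code_trm P))"

fun code_barb :: "barb \<Rightarrow> nat" where
  "code_barb (BIn a) = prod_encode (0, a)"
| "code_barb (BOut a) = prod_encode (1, a)"

fun code_eventual :: "trm \<times> trm list \<times> barb \<Rightarrow> nat" where
  "code_eventual (P, M, e) =
     prod_encode (code_trm P, prod_encode (list_encode (map code_trm M), code_barb e))"

fun code_bounded :: "trm \<times> trm list \<times> barb \<times> nat \<Rightarrow> nat" where
  "code_bounded (P, M, e, k) = prod_encode (code_eventual (P, M, e), k)"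

lemma code_inj:
  "code_prefix \<pi> = code_prefix \<pi>' \<Longrightarrow> \<pi> = \<pi>'"
  "code_trm P = code_trm P' \<Longrightarrow> P = P'"
proof (induction \<pi> and P arbitrary: \<pi>' and P' rule: code_prefix_code_trm.induct)
  case (1 a) then show ?case by (cases \<pi>') auto
next
  case (2 a) then show ?case by (cases \<pi>') auto
next
  case (3 a U) then show ?case by (cases \<pi>') auto
next
  case 4 then show ?case by (cases P') auto
next
  case 5 then show ?case by (cases P') auto
next
  case (6 a P) then show ?case by (cases P') auto
next
  case (7 P Q) then show ?case by (cases P') auto
next
  case (8 xs)
  let ?c = "\<lambda>(\<pi>, P). prod_encode (code_prefix \<pi>, code_trm P)"
  from "8.prems" obtain ys where P': "P' = Choice ys" and eq: "map ?c xs = map ?c ys"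
    by (cases P') (auto dest: inj_onD[OF inj_list_encode])
  from eq have "xs = ys"
  proof (rule list.inj_map_strong[rotated])
    fix x y
    assume x: "x \<in> set xs" and c: "?c x = ?c y"
    obtain \<pi> P where xe: "x = (\<pi>, P)" by (cases x)
    obtain \<rho> R where ye: "y = (\<rho>, R)" by (cases y)
    from c have "code_prefix \<pi> = code_prefix \<rho>" "code_trm P = code_trm R"
      by (auto simp: xe ye)
    with "8.IH"[OF x] have "\<pi> = \<rho>" "P = R" by (auto simp: xe)
    then show "x = y" by (simp add: xe ye)
  qed
  with P' show ?case by simp
next
  case (9 \<pi> P) then show ?case by (cases P') auto
qed

lemma inj_code_eventual: "inj code_eventual"
proof (rule injI)
  fix x y
  assume eq: "code_eventual x = code_eventual y"
  obtain P M e where x: "x = (P, M, e)" by (cases x)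
  obtain P' M' e' where y: "y = (P', M', e')" by (cases y)
  have inj: "inj code_trm" by (rule injI) (rule code_inj)
  from eq have "code_trm P = code_trm P'" "map code_trm M = map code_trm M'"
    and b: "code_barb e = code_barb e'"
    by (simp_all add: x y prod_encode_eq list_encode_eq)
  then have "P = P'" "M = M'" using inj by (auto dest: injD simp: inj_map_eq_map)
  moreover from b have "e = e'" by (cases e; cases e') (simp_all add: prod_encode_eq)
  ultimately show "x = y" by (simp add: x y)
qed

lemma inj_code_bounded: "inj code_bounded"
proof (rule injI)
  fix x y
  assume eq: "code_bounded x = code_bounded y"
  obtain P M e k where x: "x = (P, M, e, k)" by (cases x)
  obtain P' M' e' k' where y: "y = (P', M', e', k')" by (cases y)
  from eq have "code_eventual (P, M, e) = code_eventual (P', M', e')" "k = k'"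
    unfolding x y code_bounded.simps prod_encode_eq prod.inject by blast+
  with injD[OF inj_code_eventual] show "x = y" by (force simp only: x y)
qed

end

theory Submission
  imports Defs
begin

text \<open>
  A partial recursive function is run by a loop program over registers, and a loop program by a
  static process. Register \<open>r\<close> is the located process \<open>Loc r Q\<close>, where \<open>Q\<close> is the unary numeral: an update
  whose pattern has its hole under an output prefix increments it without changing the containment
  structure, communication with \<open>Q\<close> decrements it or detects zero, and each loop is a replicated input.
  The process is deterministic: up to the arrangement of its parallel threads, every state on its
  run has one reduction.

  If a recursive function decided adaptation, a process could apply it to the process's own code:
  this code is built from the code of the process without its input register, which is what that
  register holds. On the answer "adapts" the process offers the barb forever, otherwise
  it stops without ever having offered it; both answers are wrong. As the assumed decider is total on instances,
  only convergent computations need to be simulated, and one construction refutes bounded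
  adaptation (with \<open>k = 1\<close>) and eventual adaptation (both with empty \<open>M\<close>).
\<close>

section \<open>Parallel compositions as multisets of threads\<close>

text \<open>Only parallel composition is flattened; a located process stays one thread. The inactive
  process vanishes, so finished branches leave no residue and states can be compared as
  multisets.\<close>

fun threads :: "trm \<Rightarrow> trm multiset" where
  "threads (Par P Q) = threads P + threads Q"
| "threads (Choice xs) = (if xs = [] then {#} else {#Choice xs#})"
| "threads P = {#P#}"

text \<open>Adaptation substitutes for \<open>Star\<close> throughout the derivative of the emitting
  side. Star-freeness of a state ensures that this affects only the thread that made the
  emission.\<close>

definition star_free :: "trm \<Rightarrow> bool" where
  "star_free P \<longleftrightarrow> (\<forall>R. subst_star P R = P)"

lemma star_free_simps [simp]:
  "star_free Hole"
  "\<not> star_free Star"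
  "star_free (Loc a P) \<longleftrightarrow> star_free P"
  "star_free (Par P Q) \<longleftrightarrow> star_free P \<and> star_free Q"
  "star_free (Rep \<pi> P) \<longleftrightarrow> star_free P"
  "star_free (Choice []) \<longleftrightarrow> True"
  "star_free (Choice ((\<pi>, P) # xs)) \<longleftrightarrow> star_free P \<and> star_free (Choice xs)"
  by (auto simp: star_free_def)

lemma star_free_threads: "star_free P \<longleftrightarrow> (\<forall>t\<in>#threads P. star_free t)"
  by (induction P rule: threads.induct) auto

fun plug :: "trm \<Rightarrow> trm option \<Rightarrow> trm" where
  "plug P None = P"
| "plug P (Some R) = subst_star P R"

lemma plug_Par [simp]: "plug (Par P Q) x = Par (plug P x) (plug Q x)"
  by (cases x) auto

lemma plug_star_free [simp]: "star_free P \<Longrightarrow> plug P x = P"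
  by (cases x) (auto simp: star_free_def)

text \<open>\<open>None\<close> marks a communication and \<open>Some\<close> the process that an
  adaptation puts in place of \<open>Star\<close>. With \<open>plug\<close>, the four
  synchronisation rules are handled as two mirror images.\<close>

inductive react :: "label \<Rightarrow> label \<Rightarrow> trm option \<Rightarrow> bool" where
  "react (LIn a) (LOut a) None"
| "static_cond a U R \<Longrightarrow> react (LLoc a R) (LUpd a U) (Some (fill U R))"

lemma react_not_tau: "react \<alpha> \<beta> x \<Longrightarrow> \<alpha> \<noteq> LTau \<and> \<beta> \<noteq> LTau"
  by (auto elim: react.cases)

lemma static_trans_react:
  assumes "static_trans P \<alpha> P'" "static_trans Q \<beta> Q'" "react \<alpha> \<beta> x"
  shows "static_trans (Par P Q) LTau (Par (plug P' x) Q')"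
    and "static_trans (Par Q P) LTau (Par Q' (plug P' x))"
  using assms(3,1,2) by (induction rule: react.induct) (auto intro: static_trans.intros)

section \<open>Reduction of thread multisets and its agreement with reduction of terms\<close>

inductive mred :: "trm multiset \<Rightarrow> trm multiset \<Rightarrow> bool" where
  mred_tau: "static_trans t LTau t' \<Longrightarrow> mred (add_mset t N) (N + threads t')"
| mred_react: "static_trans t \<alpha> t' \<Longrightarrow> static_trans u \<beta> u' \<Longrightarrow> react \<alpha> \<beta> x \<Longrightarrow>
     mred (add_mset t (add_mset u N)) (N + threads (plug t' x) + threads u')"

lemma mred_union: "mred M M' \<Longrightarrow> mred (M + N) (M' + N)"
proof (induction rule: mred.induct)
  case (mred_tau t t' L)
  from mred.mred_tau[OF this, of "L + N"] show ?case by (simp add: ac_simps)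
next
  case (mred_react t \<alpha> t' u \<beta> u' x L)
  from mred.mred_react[OF this, of "L + N"] show ?case by (simp add: ac_simps)
qed

text \<open>A visible label passes unchanged through parallel contexts, so it comes from a single
  thread; only \<open>LTau\<close> can arise from two. The clause with \<open>plug\<close> lets an
  adaptation be carried out on that thread alone.\<close>

lemma visible_thread:
  assumes "static_trans P \<alpha> P'" "\<alpha> \<noteq> LTau"
  obtains t N t' where "threads P = add_mset t N" "static_trans t \<alpha> t'"
    "threads P' = N + threads t'"
    "\<And>x. star_free P \<Longrightarrow> threads (plug P' x) = N + threads (plug t' x)"
proof -
  have "\<exists>t N t'. threads P = add_mset t N \<and> static_trans t \<alpha> t' \<and> threads P' = N + threads t' \<and>
      (star_free P \<longrightarrow> (\<forall>x. threads (plug P' x) = N + threads (plug t' x)))"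
    using assms
  proof (induction rule: static_trans.induct)
    case (1 a P)
    then show ?case by (auto intro!: exI[of _ "Loc a P"] exI[of _ Star] static_trans.intros)
  next
    case (2 \<pi> P xs)
    from static_trans.intros(2)[OF 2(1)] 2 show ?case
      by (intro exI[of _ "Choice xs"] exI[of _ "{#}"] exI[of _ P]) auto
  next
    case (3 \<pi> P)
    show ?case
      by (intro exI[of _ "Rep \<pi> P"] exI[of _ "{#}"] exI[of _ "Par P (Rep \<pi> P)"])
        (auto intro: static_trans.intros)
  next
    case (4 P \<alpha> P' a)
    then show ?case
      by (intro exI[of _ "Loc a P"] exI[of _ "{#}"] exI[of _ "Loc a P'"])
        (auto intro: static_trans.intros)
  next
    case (5 P \<alpha> P' Q)
    then obtain t N t' where "threads P = add_mset t N" "static_trans t \<alpha> t'"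
      "threads P' = N + threads t'"
      "star_free P \<longrightarrow> (\<forall>x. threads (plug P' x) = N + threads (plug t' x))" by blast
    then show ?case
      by (intro exI[of _ t] exI[of _ "N + threads Q"] exI[of _ t']) (auto simp: ac_simps)
  next
    case (6 P \<alpha> P' Q)
    then obtain t N t' where "threads P = add_mset t N" "static_trans t \<alpha> t'"
      "threads P' = N + threads t'"
      "star_free P \<longrightarrow> (\<forall>x. threads (plug P' x) = N + threads (plug t' x))" by blast
    then show ?case
      by (intro exI[of _ t] exI[of _ "threads Q + N"] exI[of _ t']) (auto simp: ac_simps)
  qed auto
  then show thesis using that by blast
qed

lemma mred_threads_react:
  assumes "static_trans P \<alpha> P'" "static_trans Q \<beta> Q'" "react \<alpha> \<beta> x" "star_free P"
  shows "mred (threads P + threads Q) (threads (plug P' x) + threads Q')"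
proof -
  obtain t L t' where t: "threads P = add_mset t L" "static_trans t \<alpha> t'"
    "\<And>x. star_free P \<Longrightarrow> threads (plug P' x) = L + threads (plug t' x)"
    using visible_thread[OF assms(1)] react_not_tau[OF assms(3)] by metis
  obtain u N u' where u: "threads Q = add_mset u N" "static_trans u \<beta> u'"
    "threads Q' = N + threads u'"
    using visible_thread[OF assms(2)] react_not_tau[OF assms(3)] by metis
  from mred_react[OF t(2) u(2) assms(3), of "L + N"] assms(4) show ?thesis
    by (simp add: t(1,3) u(1,3) ac_simps add_mset_commute)
qed

text \<open>Below some parallel context, every \<open>LTau\<close> step is either a step beneath a
  location or a reaction between the two sides of a composition; \<open>mred_union\<close> adds the
  context.\<close>

lemma static_red_mred:
  assumes "static_red P P'" "star_free P"
  shows "mred (threads P) (threads P')"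
proof -
  have "static_trans P LTau P'" using assms(1) by (simp add: static_red_def)
  then show ?thesis using assms(2)
  proof (induction P LTau P' rule: static_trans.induct)
    case (2 \<pi> P xs)
    then show ?case by (cases \<pi>) auto
  next
    case (3 \<pi> P)
    then show ?case by (cases \<pi>) auto
  next
    case (4 P P' a)
    from mred_tau[OF static_trans.intros(4)[OF 4(1)], of a "{#}"] show ?case by simp
  next
    case (5 P P' Q)
    then show ?case using mred_union[of "threads P" "threads P'" "threads Q"] by simp
  next
    case (6 P P' Q)
    then show ?case using mred_union[of "threads P" "threads P'" "threads Q"]
      by (simp add: ac_simps)
  next
    case (7 P a P' Q Q')
    from mred_threads_react[OF 7(1,2) react.intros(1)] 7(3) show ?case by simp
  next
    case (8 P a P' Q Q')
    from mred_threads_react[OF 8(1,2) react.intros(1)] 8(3) show ?case by (simp add: add.commute)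
  next
    case (9 P a R P' Q U Q')
    from mred_threads_react[OF 9(1,2) react.intros(2)[OF 9(3)]] 9(4) show ?case by simp
  next
    case (10 P a R P' Q U Q')
    from mred_threads_react[OF 10(1,2) react.intros(2)[OF 10(3)]] 10(4) show ?case
      by (simp add: add.commute)
  qed
qed

text \<open>Converse of \<open>visible_thread\<close>, by descending along the parallel compositions
  to an occurrence of \<open>t\<close>; here \<open>LTau\<close> is covered as well.\<close>

lemma thread_lift:
  assumes "threads P = add_mset t N" "static_trans t \<alpha> t'"
  shows "\<exists>P'. static_trans P \<alpha> P' \<and> threads P' = N + threads t' \<and>
    (star_free P \<longrightarrow> (\<forall>x. threads (plug P' x) = N + threads (plug t' x)))"
  using assms
proof (induction P arbitrary: N rule: threads.induct)
  case (1 P Q)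
  from 1(3) have "t \<in># threads P \<or> t \<in># threads Q"
    by (metis threads.simps(1) union_iff union_single_eq_member)
  then show ?case
  proof
    assume "t \<in># threads P"
    then obtain L where L: "threads P = add_mset t L" by (metis mset_add)
    with 1(3) have N: "N = L + threads Q" by simp
    from 1(1)[OF L 1(4)] obtain P' where P': "static_trans P \<alpha> P'" "threads P' = L + threads t'"
      "star_free P \<longrightarrow> (\<forall>x. threads (plug P' x) = L + threads (plug t' x))" by blast
    then show ?thesis
      by (intro exI[of _ "Par P' Q"]) (auto simp: N ac_simps intro: static_trans.intros)
  next
    assume "t \<in># threads Q"
    then obtain L where L: "threads Q = add_mset t L" by (metis mset_add)
    with 1(3) have N: "N = threads P + L" by simp
    from 1(2)[OF L 1(4)] obtain Q' where Q': "static_trans Q \<alpha> Q'" "threads Q' = L + threads t'"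
      "star_free Q \<longrightarrow> (\<forall>x. threads (plug Q' x) = L + threads (plug t' x))" by blast
    then show ?thesis
      by (intro exI[of _ "Par P Q'"]) (auto simp: N ac_simps intro: static_trans.intros)
  qed
qed (auto split: if_splits)

text \<open>The two threads are followed down the term until they part. At that composition one of
  the two mirror-image rules applies, and the contexts above pass the \<open>LTau\<close> step
  on.\<close>

lemma react_lift:
  assumes "threads P = add_mset t (add_mset u N)"
    and tr: "static_trans t \<alpha> t'" "static_trans u \<beta> u'" "react \<alpha> \<beta> x" and "star_free P"
  shows "\<exists>P'. static_trans P LTau P' \<and> threads P' = N + threads (plug t' x) + threads u'"
  using assms(1,5)
proof (induction P arbitrary: N rule: threads.induct)
  case (1 P Q)
  have sf: "star_free P" "star_free Q" using 1(4) by auto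
  have lift: "\<exists>R'. static_trans (Par P Q) LTau R' \<and> threads R' = N + threads (plug t' x) + threads u'"
    if "(threads P = add_mset t L \<and> threads Q = add_mset u L') \<or>
        (threads Q = add_mset t L \<and> threads P = add_mset u L')" "N = L + L'" for L L'
    using that(1)
  proof (elim disjE conjE)
    assume a: "threads P = add_mset t L" "threads Q = add_mset u L'"
    from thread_lift[OF a(1) tr(1)] thread_lift[OF a(2) tr(2)] obtain P' Q' where
      "static_trans P \<alpha> P'" "threads (plug P' x) = L + threads (plug t' x)"
      "static_trans Q \<beta> Q'" "threads Q' = L' + threads u'" using sf by blast
    with static_trans_react(1)[OF _ _ tr(3)] show ?thesis
      by (intro exI[of _ "Par (plug P' x) Q'"]) (auto simp: that(2) ac_simps)
  next
    assume a: "threads Q = add_mset t L" "threads P = add_mset u L'"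
    from thread_lift[OF a(1) tr(1)] thread_lift[OF a(2) tr(2)] obtain P' Q' where
      "static_trans P \<beta> P'" "threads (plug Q' x) = L + threads (plug t' x)"
      "static_trans Q \<alpha> Q'" "threads P' = L' + threads u'" using sf by blast
    with static_trans_react(2)[OF _ _ tr(3)] show ?thesis
      by (intro exI[of _ "Par P' (plug Q' x)"]) (auto simp: that(2) ac_simps)
  qed
  from 1(3) have "t \<in># threads P \<or> t \<in># threads Q"
    by (metis threads.simps(1) union_iff union_single_eq_member)
  then show ?case
  proof
    assume "t \<in># threads P"
    then obtain L where L: "threads P = add_mset t L" by (metis mset_add)
    with 1(3) have N: "add_mset u N = L + threads Q" by simp
    then have "u \<in># L \<or> u \<in># threads Q" by (metis union_iff union_single_eq_member)
    then show ?thesis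
    proof
      assume "u \<in># L"
      then obtain L' where L': "L = add_mset u L'" by (metis mset_add)
      from 1(1)[OF L[unfolded L'] sf(1)] obtain P' where
        "static_trans P LTau P'" "threads P' = L' + threads (plug t' x) + threads u'" by blast
      with N L' show ?thesis
        by (intro exI[of _ "Par P' Q"]) (auto simp: ac_simps intro: static_trans.intros)
    next
      assume "u \<in># threads Q"
      then obtain L' where L': "threads Q = add_mset u L'" by (metis mset_add)
      then have "N = L + L'" using N by simp
      with lift L L' show ?thesis by blast
    qed
  next
    assume "t \<in># threads Q"
    then obtain L where L: "threads Q = add_mset t L" by (metis mset_add)
    with 1(3) have N: "add_mset u N = threads P + L" by simp
    then have "u \<in># L \<or> u \<in># threads P" by (metis union_iff union_single_eq_member)
    then show ?thesis
    proof
      assume "u \<in># L"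
      then obtain L' where L': "L = add_mset u L'" by (metis mset_add)
      from 1(2)[OF L[unfolded L'] sf(2)] obtain Q' where
        "static_trans Q LTau Q'" "threads Q' = L' + threads (plug t' x) + threads u'" by blast
      with N L' show ?thesis
        by (intro exI[of _ "Par P Q'"]) (auto simp: ac_simps intro: static_trans.intros)
    next
      assume "u \<in># threads P"
      then obtain L' where L': "threads P = add_mset u L'" by (metis mset_add)
      then have "N = L + L'" using N by (simp add: add.commute)
      with lift L L' show ?thesis by blast
    qed
  qed
qed (auto split: if_splits)

lemma mred_static_red:
  assumes "mred (threads P) M'" "star_free P"
  shows "\<exists>P'. static_red P P' \<and> threads P' = M'"
  using assms(1)
proof cases
  case (mred_tau t t' N)
  from thread_lift[OF mred_tau(1,3)] show ?thesis
    unfolding mred_tau(2) static_red_def by fast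
next
  case (mred_react t \<alpha> t' u \<beta> u' x N)
  show ?thesis
    unfolding mred_react(2) static_red_def by (rule react_lift[OF mred_react(1,3,4,5) assms(2)])
qed

section \<open>Deterministic runs\<close>

text \<open>Names that are 3 modulo 4 are not used as channels of registers or loops.\<close>

definition bell :: name where "bell = 3"

definition silent :: "trm multiset \<Rightarrow> bool" where
  "silent M \<longleftrightarrow> (\<forall>t\<in>#M. star_free t \<and> (\<forall>t'. \<not> static_trans t (LOut bell) t'))"

text \<open>Uniqueness concerns the multiset of threads, not the term. Only the source must be
  silent, so a run may end in a state that offers \<open>bell\<close>.\<close>

definition det_step :: "trm multiset \<Rightarrow> trm multiset \<Rightarrow> bool" where
  "det_step M M' \<longleftrightarrow> silent M \<and> mred M M' \<and> (\<forall>M''. mred M M'' \<longrightarrow> M'' = M')"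

lemma silent_no_barb:
  assumes "silent (threads P)" shows "\<not> has_barb P (BOut bell)"
proof
  assume "has_barb P (BOut bell)"
  then obtain P' where "static_trans P (LOut bell) P'" by (auto simp: has_barb_def)
  then obtain t N t' where "threads P = add_mset t N" "static_trans t (LOut bell) t'"
    by (rule visible_thread) auto
  with assms show False by (auto simp: silent_def)
qed

lemma silent_star_free: "silent (threads P) \<Longrightarrow> star_free P"
  using star_free_threads[of P] by (simp add: silent_def)

lemma det_run_reaches:
  assumes "det_step\<^sup>*\<^sup>* (threads P) M"
  shows "\<exists>Q. static_red\<^sup>*\<^sup>* P Q \<and> threads Q = M"
  using assms
proof (induction rule: rtranclp_induct)
  case base
  then show ?case by blast
next
  case (step M M')
  then obtain Q where Q: "static_red\<^sup>*\<^sup>* P Q" "threads Q = M" by blast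
  from step(2) have "silent (threads Q)" "mred (threads Q) M'" by (auto simp: det_step_def Q(2))
  then obtain Q' where "static_red Q Q'" "threads Q' = M'"
    using mred_static_red silent_star_free by blast
  with rtranclp.rtrancl_into_rtrancl[OF Q(1)] show ?case by blast
qed

text \<open>No reduction can leave a deterministic run, so every reduct of \<open>P\<close> still
  has a deterministic run to \<open>M\<close>; all states on it, including the stuck end, are
  silent.\<close>

lemma det_run_safe:
  assumes "det_step\<^sup>*\<^sup>* (threads P) M" "silent M" "\<And>M'. \<not> mred M M'" "static_red\<^sup>*\<^sup>* P Q"
  shows "\<not> has_barb Q (BOut bell)"
proof -
  have *: "det_step\<^sup>*\<^sup>* (threads Q) M \<and> silent (threads Q)"
    using assms(4)
  proof (induction rule: rtranclp_induct)
    case base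
    from assms(1) have "silent (threads P)"
      by (cases rule: converse_rtranclpE) (use assms(2) in \<open>auto simp: det_step_def\<close>)
    with assms(1) show ?case by blast
  next
    case (step Q Q')
    then have m: "mred (threads Q) (threads Q')" by (simp add: static_red_mred silent_star_free)
    from step(3) have "det_step\<^sup>*\<^sup>* (threads Q) M" by simp
    \<comment> \<open>The run to \<open>M\<close> has at least one step because \<open>M\<close> is
      stuck, and determinism identifies its first step with the reduction taken.\<close>
    then have "det_step\<^sup>*\<^sup>* (threads Q') M"
      by (cases rule: converse_rtranclpE) (use m assms(3) in \<open>auto simp: det_step_def\<close>)
    moreover from this have "silent (threads Q')"
      by (cases rule: converse_rtranclpE) (use assms(2) in \<open>auto simp: det_step_def\<close>)
    ultimately show ?case by blast
  qed
  then show ?thesis by (simp add: silent_no_barb)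
qed

inductive_cases rec_evalE:
  "rec_eval Zero xs y" "rec_eval Succ xs y" "rec_eval (Proj i) xs y" "rec_eval (Comp f gs) xs y"
  "rec_eval (Prim f g) xs y" "rec_eval (Prim f g) (0 # xs) y" "rec_eval (Prim f g) (Suc n # xs) y"
  "rec_eval (Mu f) xs y"

section \<open>Loop programs\<close>

text \<open>\<open>Loop r c\<close> decrements \<open>r\<close> before each pass, and
  \<open>c\<close> may increase \<open>r\<close> again; this makes the loops unbounded, as
  minimisation requires.\<close>

datatype cmd = Skip | Inc nat | Seq cmd cmd | Loop nat cmd

inductive exec :: "cmd \<Rightarrow> (nat \<Rightarrow> nat) \<Rightarrow> (nat \<Rightarrow> nat) \<Rightarrow> bool" where
  exec_Skip: "exec Skip s s"
| exec_Inc: "exec (Inc r) s (s(r := Suc (s r)))"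
| exec_Seq: "exec c s t \<Longrightarrow> exec c' t u \<Longrightarrow> exec (Seq c c') s u"
| exec_Loop_0: "s r = 0 \<Longrightarrow> exec (Loop r c) s s"
| exec_Loop_Suc: "s r = Suc n \<Longrightarrow> exec c (s(r := n)) t \<Longrightarrow> exec (Loop r c) t u \<Longrightarrow>
     exec (Loop r c) s u"

lemma exec_eq: "exec c s t \<Longrightarrow> t = t' \<Longrightarrow> exec c s t'"
  by simp

text \<open>\<open>st i\<close> is the state after \<open>i\<close> passes. The induction is on the
  number of passes left, because \<open>exec_Loop_Suc\<close> prepends a pass.\<close>

lemma exec_Loop_iterate:
  assumes "\<And>i. i \<le> n \<Longrightarrow> st i r = n - i"
    and "\<And>i. i < n \<Longrightarrow> exec c ((st i)(r := n - Suc i)) (st (Suc i))"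
  shows "exec (Loop r c) (st 0) (st n)"
proof -
  have "exec (Loop r c) (st (n - k)) (st n)" if "k \<le> n" for k
    using that
  proof (induction k)
    case 0
    then show ?case using assms(1)[of n] by (auto intro: exec_Loop_0)
  next
    case (Suc k)
    let ?i = "n - Suc k"
    have i: "Suc ?i = n - k" "n - Suc ?i = k" using Suc.prems by auto
    have "st ?i r = Suc k" using assms(1)[of ?i] Suc.prems by simp
    moreover have "exec c ((st ?i)(r := k)) (st (n - k))"
      using assms(2)[of ?i] Suc.prems unfolding i by simp
    ultimately show ?case using Suc by (auto intro: exec_Loop_Suc)
  qed
  from this[of n] show ?thesis by simp
qed

definition clear :: "nat \<Rightarrow> cmd" where
  "clear r = Loop r Skip"

definition move :: "nat \<Rightarrow> nat \<Rightarrow> cmd" where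
  "move a b = Loop a (Inc b)"

text \<open>Reading a register destroys it, so the first loop also fills \<open>d\<close>, from
  which \<open>a\<close> is then restored.\<close>

definition copy :: "nat \<Rightarrow> nat \<Rightarrow> nat \<Rightarrow> cmd" where
  "copy a b d = Seq (Loop a (Seq (Inc b) (Inc d))) (move d a)"

lemma exec_clear: "exec (clear r) s (s(r := 0))"
proof -
  have "exec (Loop r Skip) (s(r := s r - 0)) (s(r := s r - s r))"
    by (rule exec_Loop_iterate[where st = "\<lambda>i. s(r := s r - i)"]) (auto intro: exec_Skip)
  then show ?thesis by (simp add: clear_def)
qed

lemma exec_move:
  assumes "a \<noteq> b" shows "exec (move a b) s (s(b := s b + s a, a := 0))"
proof -
  have "exec (Loop a (Inc b)) (s(b := s b + 0, a := s a - 0)) (s(b := s b + s a, a := s a - s a))"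
    by (rule exec_Loop_iterate[where st = "\<lambda>i. s(b := s b + i, a := s a - i)"])
      (use assms in \<open>auto intro!: exec_eq[OF exec_Inc]\<close>)
  then show ?thesis by (simp add: move_def)
qed

lemma exec_copy:
  assumes "a \<noteq> b" "a \<noteq> d" "b \<noteq> d" "s d = 0"
  shows "exec (copy a b d) s (s(b := s b + s a))"
proof -
  have "exec (Loop a (Seq (Inc b) (Inc d))) (s(b := s b + 0, d := 0, a := s a - 0))
      (s(b := s b + s a, d := s a, a := s a - s a))"
    by (rule exec_Loop_iterate[where st = "\<lambda>i. s(b := s b + i, d := i, a := s a - i)"])
      (use assms in \<open>auto intro!: exec_Seq[OF exec_Inc] exec_eq[OF exec_Inc]\<close>)
  with assms(4) have "exec (Loop a (Seq (Inc b) (Inc d))) s (s(b := s b + s a, d := s a, a := 0))"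
    by (simp add: fun_upd_idem)
  then show ?thesis unfolding copy_def
    by (rule exec_Seq) (use assms in \<open>auto intro!: exec_eq[OF exec_move]\<close>)
qed

text \<open>
  \<open>compile f rs q d\<close> computes \<open>f\<close> on the registers \<open>rs\<close> into \<open>q\<close>; the registers from \<open>d\<close> on are
  scratch, zero before and after the run.
\<close>

fun compile :: "recf \<Rightarrow> nat list \<Rightarrow> nat \<Rightarrow> nat \<Rightarrow> cmd"
  and compile_list :: "recf list \<Rightarrow> nat list \<Rightarrow> nat \<Rightarrow> nat \<Rightarrow> cmd"
where
  "compile Zero rs q d = Skip"
| "compile Succ rs q d = Seq (copy (rs ! 0) q d) (Inc q)"
| "compile (Proj i) rs q d = copy (rs ! i) q d"
| "compile (Comp f gs) rs q d =
     (let e = d + length gs in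
      Seq (compile_list gs rs d e)
        (Seq (compile f [d..<e] q e) (foldr (\<lambda>r. Seq (clear r)) [d..<e] Skip)))"
| "compile (Prim f g) rs q d =
     Seq (copy (rs ! 0) (d + 1) (d + 2))
       (Seq (compile f (tl rs) (d + 2) (d + 4))
         (Seq (Loop (d + 1)
            (Seq (compile g (d # (d + 2) # tl rs) (d + 3) (d + 4))
              (Seq (clear (d + 2)) (Seq (move (d + 3) (d + 2)) (Inc d)))))
           (Seq (move (d + 2) q) (clear d))))"
| "compile (Mu f) rs q d =
     Seq (Inc (d + 1))
       (Seq (Loop (d + 1)
          (Seq (compile f (d # rs) (d + 2) (d + 3))
            (Loop (d + 2) (Seq (clear (d + 2)) (Seq (Inc (d + 1)) (Inc d))))))
         (move d q))"
| "compile_list [] rs q d = Skip"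
| "compile_list (g # gs) rs q d = Seq (compile g rs q d) (compile_list gs rs (Suc q) d)"

text \<open>The derivation descends from \<open>n\<close>, whereas the program counts upwards; the
  sequence \<open>v\<close> of intermediate values is what its loop keeps in a register.\<close>

lemma Prim_trace:
  "rec_eval (Prim f g) (n # xs) y \<Longrightarrow>
   \<exists>v. rec_eval f xs (v 0) \<and> (\<forall>i<n. rec_eval g (i # v i # xs) (v (Suc i))) \<and> v n = y"
proof (induction n arbitrary: y)
  case 0
  then show ?case by (auto elim: rec_evalE(6))
next
  case (Suc n)
  from Suc.prems obtain r where r: "rec_eval (Prim f g) (n # xs) r" "rec_eval g (n # r # xs) y"
    by (elim rec_evalE(7))
  from Suc.IH[OF r(1)] obtain v where
    "rec_eval f xs (v 0)" "\<forall>i<n. rec_eval g (i # v i # xs) (v (Suc i))" "v n = r" by blast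
  with r(2) show ?case by (intro exI[of _ "v(Suc n := y)"]) (auto simp: less_Suc_eq)
qed

text \<open>Every register except \<open>q\<close> is returned unchanged, which lets subprograms
  reuse the same inputs and scratch registers one after the other.\<close>

definition computes :: "(nat list \<Rightarrow> nat \<Rightarrow> nat \<Rightarrow> cmd) \<Rightarrow> nat list \<Rightarrow> nat \<Rightarrow> bool" where
  "computes C xs y \<longleftrightarrow> (\<forall>rs q d s. map s rs = xs \<longrightarrow> set rs \<subseteq> {..<d} \<longrightarrow> q < d \<longrightarrow> q \<notin> set rs \<longrightarrow>
     s q = 0 \<longrightarrow> (\<forall>i\<ge>d. s i = 0) \<longrightarrow> exec (C rs q d) s (s(q := y)))"

lemma exec_computes:
  assumes "computes C xs y" "map s rs = xs" "set rs \<subseteq> {..<d}" "q < d" "q \<notin> set rs"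
    "s q = 0" "\<And>i. i \<ge> d \<Longrightarrow> s i = 0" "t = s(q := y)"
  shows "exec (C rs q d) s t"
  using assms by (auto simp: computes_def)

text \<open>The inputs lie below the block of results and the scratch registers above it, so no
  program disturbs results already computed.\<close>

lemma exec_compile_list:
  assumes "list_all2 (\<lambda>g y. computes (compile g) xs y) gs ys" "map s rs = xs"
    "set rs \<subseteq> {..<q}" "q + length gs \<le> d" "\<And>i. i \<ge> q \<Longrightarrow> s i = 0"
  shows "exec (compile_list gs rs q d) s (\<lambda>i. if q \<le> i \<and> i < q + length ys then ys ! (i - q) else s i)"
  using assms
proof (induction gs ys arbitrary: q s rule: list_all2_induct)
  case Nil
  then show ?case by (auto intro!: exec_eq[OF exec_Skip])
next
  case (Cons g gs y ys)
  have rs: "set rs \<subseteq> {..<d}" "q \<notin> set rs" using Cons.prems by auto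
  have "exec (compile g rs q d) s (s(q := y))"
    by (rule exec_computes[OF Cons.hyps(1)]) (use Cons.prems rs in auto)
  moreover have "exec (compile_list gs rs (Suc q) d) (s(q := y))
      (\<lambda>i. if Suc q \<le> i \<and> i < Suc q + length ys then ys ! (i - Suc q) else (s(q := y)) i)"
    by (rule Cons.IH) (use Cons.prems rs in \<open>auto simp: map_fun_upd\<close>)
  moreover have "(\<lambda>i. if Suc q \<le> i \<and> i < Suc q + length ys then ys ! (i - Suc q) else (s(q := y)) i) =
      (\<lambda>i. if q \<le> i \<and> i < q + length (y # ys) then (y # ys) ! (i - q) else s i)"
    by (rule ext) (auto simp: nth_Cons')
  ultimately show ?case by (auto intro: exec_Seq)
qed

lemma exec_clears:
  "exec (foldr (\<lambda>r. Seq (clear r)) rs Skip) s (\<lambda>i. if i \<in> set rs then 0 else s i)"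
proof (induction rs arbitrary: s)
  case Nil
  then show ?case by (auto intro!: exec_eq[OF exec_Skip])
next
  case (Cons r rs)
  show ?case
    by (auto intro!: exec_Seq[OF exec_clear] exec_eq[OF Cons])
qed

text \<open>By induction on \<open>f\<close>; the derivation is inverted to obtain the values of the
  component functions, which become the contents of registers.\<close>

lemma computes_compile: "rec_eval f xs y \<Longrightarrow> computes (compile f) xs y"
proof (induction f arbitrary: xs y)
  case Zero
  then show ?case
    by (auto simp: computes_def elim!: rec_evalE(1) intro!: exec_eq[OF exec_Skip])
next
  case Succ
  then obtain x where x: "xs = [x]" "y = Suc x" by (elim rec_evalE(2))
  show ?case unfolding computes_def x
  proof (intro allI impI)
    fix rs :: "nat list" and q d and s :: "nat \<Rightarrow> nat"
    assume a: "map s rs = [x]" "set rs \<subseteq> {..<d}" "q < d" "q \<notin> set rs" "s q = 0"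
      "\<forall>i\<ge>d. s i = (0::nat)"
    then obtain r where "rs = [r]" by auto
    with a show "exec (compile Succ rs q d) s (s(q := Suc x))"
      by (auto intro!: exec_Seq[OF exec_copy] exec_eq[OF exec_Inc])
  qed
next
  case (Proj i)
  then have x: "i < length xs" "y = xs ! i" by (auto elim: rec_evalE(3))
  show ?case unfolding computes_def
  proof (intro allI impI)
    fix rs :: "nat list" and q d and s :: "nat \<Rightarrow> nat"
    assume a: "map s rs = xs" "set rs \<subseteq> {..<d}" "q < d" "q \<notin> set rs" "s q = 0"
      "\<forall>i\<ge>d. s i = (0::nat)"
    then have "rs ! i \<in> set rs" using x by auto
    then have "rs ! i < d" "rs ! i \<noteq> q" using a by auto
    with a x show "exec (compile (Proj i) rs q d) s (s(q := y))"
      by (auto intro!: exec_eq[OF exec_copy])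
  qed
next
  case (Comp f gs)
  from Comp.prems obtain ys where "list_all2 (\<lambda>g y. rec_eval g xs y) gs ys"
    and f: "rec_eval f ys y" by (elim rec_evalE(4))
  then have ys: "list_all2 (\<lambda>g y. computes (compile g) xs y) gs ys"
    using Comp.IH(2) by (auto simp: list_all2_conv_all_nth)
  then have len: "length gs = length ys" by (rule list_all2_lengthD)
  show ?case unfolding computes_def
  proof (intro allI impI)
    fix rs :: "nat list" and q d and s :: "nat \<Rightarrow> nat"
    assume a: "map s rs = xs" "set rs \<subseteq> {..<d}" "q < d" "q \<notin> set rs" "s q = 0"
      "\<forall>i\<ge>d. s i = (0::nat)"
    let ?e = "d + length gs"
    let ?t = "\<lambda>i. if d \<le> i \<and> i < d + length ys then ys ! (i - d) else s i"
    have "exec (compile_list gs rs d ?e) s ?t"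
      by (rule exec_compile_list[OF ys]) (use a in auto)
    moreover have "exec (compile f [d..<?e] q ?e) ?t (?t(q := y))"
    proof (rule exec_computes[OF Comp.IH(1)[OF f]])
      show "map ?t [d..<?e] = ys" by (auto simp: len intro!: nth_equalityI)
    qed (use a len in auto)
    moreover have "exec (foldr (\<lambda>r. Seq (clear r)) [d..<?e] Skip) (?t(q := y)) (s(q := y))"
      by (rule exec_eq[OF exec_clears]) (use a len in auto)
    ultimately show "exec (compile (Comp f gs) rs q d) s (s(q := y))"
      unfolding compile.simps Let_def by (blast intro: exec_Seq)
  qed
next
  case (Prim f g)
  from Prim.prems obtain n zs where xs: "xs = n # zs" by (rule rec_evalE(5)) auto
  from Prim_trace[OF Prim.prems[unfolded xs]] obtain v where v: "rec_eval f zs (v 0)"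
    "\<And>i. i < n \<Longrightarrow> rec_eval g (i # v i # zs) (v (Suc i))" "v n = y" by blast
  show ?case unfolding computes_def
  proof (intro allI impI)
    fix rs :: "nat list" and q d and s :: "nat \<Rightarrow> nat"
    assume a: "map s rs = xs" "set rs \<subseteq> {..<d}" "q < d" "q \<notin> set rs" "s q = 0"
      "\<forall>i\<ge>d. s i = (0::nat)"
    obtain r ts where rs: "rs = r # ts" "s r = n" "map s ts = zs"
      using a(1) unfolding xs by (cases rs) auto
    have ts: "d \<notin> set ts" "Suc d \<notin> set ts" "Suc (Suc d) \<notin> set ts" "d + 3 \<notin> set ts"
      "set ts \<subseteq> {..<d + 4}" "q < d" "r < d" "q \<notin> set ts"
      using a(2-4) by (auto simp: rs(1))
    have a': "s d = 0" "s (Suc d) = 0" "s (Suc (Suc d)) = 0" "s (d + 3) = 0" "\<And>i. i \<ge> d + 4 \<Longrightarrow> s i = 0"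
      using a(6) by auto
    let ?body = "Seq (compile g (d # (d + 2) # ts) (d + 3) (d + 4))
      (Seq (clear (d + 2)) (Seq (move (d + 3) (d + 2)) (Inc d)))"
    \<comment> \<open>Loop invariant: \<open>d\<close> is the recursion index, \<open>d + 1\<close>
      the number of passes left and \<open>d + 2\<close> the value reached. The next value is
      computed in \<open>d + 3\<close> and then moved.\<close>
    define st where "st i = s(d := i, d + 1 := n - i, d + 2 := v i)" for i
    have 1: "exec (copy r (d + 1) (d + 2)) s (s(d + 1 := n))"
      by (rule exec_eq[OF exec_copy]) (use a(5) a' ts rs(2,3) in auto)
    have 2: "exec (compile f ts (d + 2) (d + 4)) (s(d + 1 := n)) (st 0)"
      by (rule exec_computes[OF Prim.IH(1)[OF v(1)]])
        (use a(5) a' ts rs(2,3) in \<open>auto simp: st_def fun_upd_idem\<close>)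
    have 3: "exec (Loop (d + 1) ?body) (st 0) (st n)"
    proof (rule exec_Loop_iterate)
      fix i assume "i < n"
      let ?t = "(st i)(d + 1 := n - Suc i)"
      have "exec (compile g (d # (d + 2) # ts) (d + 3) (d + 4)) ?t (?t(d + 3 := v (Suc i)))"
        by (rule exec_computes[OF Prim.IH(2)[OF v(2)[OF \<open>i < n\<close>]]])
          (use a(5) a' ts rs(2,3) in \<open>auto simp: st_def\<close>)
      moreover have "exec (move (d + 3) (d + 2)) (?t(d + 3 := v (Suc i), d + 2 := 0))
          (?t(d + 2 := v (Suc i)))"
        by (rule exec_eq[OF exec_move]) (use a' ts in \<open>auto simp: st_def\<close>)
      moreover have "exec (Inc d) (?t(d + 2 := v (Suc i))) (st (Suc i))"
        by (rule exec_eq[OF exec_Inc]) (auto simp: st_def)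
      ultimately show "exec ?body ?t (st (Suc i))" by (blast intro: exec_Seq exec_clear)
    qed (simp add: st_def)
    have 4: "exec (move (d + 2) q) (st n) (s(d := n, q := y))"
      by (rule exec_eq[OF exec_move]) (use a(5) a' ts v(3) in \<open>auto simp: st_def\<close>)
    have 5: "exec (clear d) (s(d := n, q := y)) (s(q := y))"
      by (rule exec_eq[OF exec_clear]) (use a' ts in auto)
    show "exec (compile (Prim f g) rs q d) s (s(q := y))"
      unfolding compile.simps rs(1) nth_Cons_0 list.sel
      by (rule exec_Seq[OF 1 exec_Seq[OF 2 exec_Seq[OF 3 exec_Seq[OF 4 5]]]])
  qed
next
  case (Mu f)
  have z: "rec_eval f (y # xs) 0" and "\<forall>i<y. \<exists>z. rec_eval f (i # xs) (Suc z)"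
    using Mu.prems by (auto elim: rec_evalE(8))
  then have "\<forall>i. \<exists>z. i < y \<longrightarrow> rec_eval f (i # xs) (Suc z)" by blast
  from choice[OF this] obtain w where w: "\<And>i. i < y \<Longrightarrow> rec_eval f (i # xs) (Suc (w i))" by blast
  show ?case unfolding computes_def
  proof (intro allI impI)
    fix rs :: "nat list" and q d and s :: "nat \<Rightarrow> nat"
    assume a: "map s rs = xs" "set rs \<subseteq> {..<d}" "q < d" "q \<notin> set rs" "s q = 0"
      "\<forall>i\<ge>d. s i = (0::nat)"
    have rs: "d \<notin> set rs" "Suc d \<notin> set rs" "d + 2 \<notin> set rs" "set rs \<subseteq> {..<d + 3}"
      using a(2) by auto
    have a': "s d = 0" "s (Suc d) = 0" "s (Suc (Suc d)) = 0" "\<And>i. i \<ge> d + 3 \<Longrightarrow> s i = 0"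
      using a(6) by auto
    \<comment> \<open>A loop used as a conditional: its body clears its own register, so it runs at
      most once, and only if the value of \<open>f\<close> is nonzero. It then raises the flag
      \<open>d + 1\<close> for another pass and moves \<open>d\<close> to the next
      candidate.\<close>
    let ?retry = "Loop (d + 2) (Seq (clear (d + 2)) (Seq (Inc (d + 1)) (Inc d)))"
    let ?body = "Seq (compile f (d # rs) (d + 2) (d + 3)) ?retry"
    define st where "st i = s(d := i, d + 1 := 1)" for i
    have f: "exec (compile f (d # rs) (d + 2) (d + 3)) (s(d := i)) (s(d := i, d + 2 := z))"
      if "rec_eval f (i # xs) z" for i z
      by (rule exec_computes[OF Mu.IH[OF that]]) (use a(1) a' rs in auto)
    \<comment> \<open>Backward induction from the solution \<open>y\<close>, where the flag stays at
      zero and the search ends; each earlier candidate leads to the state of the next one.\<close>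
    have run: "exec (Loop (d + 1) ?body) (st i) (s(d := y))" if "i \<le> y" for i
      using that
    proof (induction rule: inc_induct)
      case base
      have "s(d := y, d + 2 := 0) = s(d := y)" using a'(3) by (simp add: fun_eq_iff)
      with f[OF z] have "exec (compile f (d # rs) (d + 2) (d + 3)) (s(d := y)) (s(d := y))" by simp
      moreover have "exec ?retry (s(d := y)) (s(d := y))" using a'(3) by (intro exec_Loop_0) simp
      ultimately have "exec ?body (s(d := y)) (s(d := y))" by (rule exec_Seq)
      moreover have "(st y)(d + 1 := 0) = s(d := y)" using a'(2) by (simp add: st_def fun_eq_iff)
      ultimately have "exec ?body ((st y)(d + 1 := 0)) (s(d := y))" by simp
      moreover have "exec (Loop (d + 1) ?body) (s(d := y)) (s(d := y))"
        using a'(2) by (intro exec_Loop_0) simp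
      moreover have "st y (d + 1) = Suc 0" by (simp add: st_def)
      ultimately show ?case by (blast intro: exec_Loop_Suc)
    next
      case (step i)
      let ?t = "s(d := i, d + 2 := Suc (w i))"
      have 1: "exec (clear (d + 2)) (?t(d + 2 := w i)) (s(d := i))"
        by (rule exec_eq[OF exec_clear]) (use a'(3) in \<open>simp add: fun_eq_iff\<close>)
      have 2: "exec (Inc (d + 1)) (s(d := i)) (st i)"
        by (rule exec_eq[OF exec_Inc]) (use a'(2) in \<open>simp add: st_def\<close>)
      have 3: "exec (Inc d) (st i) (st (Suc i))"
        by (rule exec_eq[OF exec_Inc]) (simp add: st_def fun_eq_iff)
      have "exec ?retry (st (Suc i)) (st (Suc i))"
        by (rule exec_Loop_0) (use a'(3) in \<open>simp add: st_def\<close>)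
      with exec_Seq[OF 1 exec_Seq[OF 2 3]] have "exec ?retry ?t (st (Suc i))"
        by (intro exec_Loop_Suc[of ?t "d + 2" "w i"]) simp_all
      with f[OF w[OF step(2)]] have "exec ?body (s(d := i)) (st (Suc i))" by (rule exec_Seq)
      moreover have "(st i)(d + 1 := 0) = s(d := i)" using a'(2) by (simp add: st_def fun_eq_iff)
      ultimately have "exec ?body ((st i)(d + 1 := 0)) (st (Suc i))" by simp
      moreover have "st i (d + 1) = Suc 0" by (simp add: st_def)
      ultimately show ?case using step(3) by (blast intro: exec_Loop_Suc)
    qed
    have 1: "exec (Inc (d + 1)) s (st 0)"
      by (rule exec_eq[OF exec_Inc]) (use a'(1,2) in \<open>simp add: st_def fun_eq_iff\<close>)
    have 2: "exec (move d q) (s(d := y)) (s(q := y))"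
      by (rule exec_eq[OF exec_move]) (use a(3,5) a'(1) in \<open>auto simp: fun_eq_iff\<close>)
    show "exec (compile (Mu f) rs q d) s (s(q := y))"
      unfolding compile.simps by (rule exec_Seq[OF 1 exec_Seq[OF run[OF le0] 2]])
  qed
qed

section \<open>Loop programs as processes\<close>

text \<open>Residues modulo 4 keep the kinds of channel apart. Locations are bare register numbers;
  \<open>LLoc\<close> and \<open>LUpd\<close> never react with \<open>LIn\<close> and
  \<open>LOut\<close>, so an equal channel number does no harm.\<close>

abbreviation unit_ch :: "nat \<Rightarrow> name" where "unit_ch r \<equiv> 4 * r"
abbreviation zero_ch :: "nat \<Rightarrow> name" where "zero_ch r \<equiv> 4 * r + 1"
abbreviation call_ch :: "nat \<Rightarrow> name" where "call_ch i \<equiv> 4 * i + 2"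

text \<open>A stack of outputs with a distinct bottom symbol. Just one output is on offer at a time,
  so the content of the register decides the outcome of a test.\<close>

fun numeral_proc :: "nat \<Rightarrow> nat \<Rightarrow> trm" where
  "numeral_proc r 0 = Choice [(Out (zero_ch r), Nil_proc)]"
| "numeral_proc r (Suc n) = Choice [(Out (unit_ch r), numeral_proc r n)]"

text \<open>The trailing \<open>Nil_proc\<close> gives the pattern the shape demanded by the static
  grammar and by \<open>static_cond\<close>, and disappears under \<open>threads\<close>.\<close>

definition set_reg :: "nat \<Rightarrow> trm \<Rightarrow> trm \<Rightarrow> trm" where
  "set_reg r U K = Choice [(Upd r (Par (Loc r U) Nil_proc), K)]"

definition test_reg :: "nat \<Rightarrow> trm \<Rightarrow> trm \<Rightarrow> trm" where
  "test_reg r K K' = Choice [(In (unit_ch r), K), (In (zero_ch r), K')]"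

definition call :: "nat \<Rightarrow> trm" where
  "call i = Choice [(Out (call_ch i), Nil_proc)]"

definition server :: "nat \<Rightarrow> trm \<Rightarrow> trm" where
  "server i B = Rep (In (call_ch i)) B"

fun num_loops :: "cmd \<Rightarrow> nat" where
  "num_loops (Seq c c') = num_loops c + num_loops c'"
| "num_loops (Loop r c) = Suc (num_loops c)"
| "num_loops _ = 0"

text \<open>
  \<open>proc c K l\<close> runs \<open>c\<close> and continues as \<open>K\<close>; the loops of \<open>c\<close> are numbered from \<open>l\<close> on, and
  \<open>loops c K l\<close> lists the bodies of the servers that they call. A zero test consumes the numeral,
  so the exit branch of a loop restores it.
\<close>

fun proc :: "cmd \<Rightarrow> trm \<Rightarrow> nat \<Rightarrow> trm" where
  "proc Skip K l = K"
| "proc (Inc r) K l = set_reg r (Choice [(Out (unit_ch r), Hole)]) K"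
| "proc (Seq c c') K l = proc c (proc c' K (l + num_loops c)) l"
| "proc (Loop r c) K l = call l"

fun loops :: "cmd \<Rightarrow> trm \<Rightarrow> nat \<Rightarrow> trm list" where
  "loops (Seq c c') K l =
     loops c (proc c' K (l + num_loops c)) l @ loops c' K (l + num_loops c)"
| "loops (Loop r c) K l =
     test_reg r (proc c (call l) (Suc l)) (set_reg r (numeral_proc r 0) K) # loops c (call l) (Suc l)"
| "loops _ K l = []"

lemma length_loops [simp]: "length (loops c K l) = num_loops c"
  by (induction c arbitrary: K l) auto

text \<open>A nonempty sum is exactly one thread, so the control part of a running program is always
  a single thread.\<close>

definition quiet :: "trm \<Rightarrow> bool" where
  "quiet K \<longleftrightarrow> star_free K \<and> (\<exists>xs. K = Choice xs \<and> xs \<noteq> [] \<and> (\<forall>P. (Out bell, P) \<notin> set xs))"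

lemma star_free_numeral [simp]: "star_free (numeral_proc r n)"
  by (induction n) auto

lemma quiet_star_free: "quiet K \<Longrightarrow> star_free K"
  by (simp add: quiet_def)

lemma threads_quiet: "quiet K \<Longrightarrow> threads K = {#K#}"
  by (auto simp: quiet_def)

lemma call_ch_bell: "call_ch i \<noteq> bell"
  unfolding bell_def by presburger

lemma reg_ch_bell: "unit_ch r \<noteq> bell" "zero_ch r \<noteq> bell"
  unfolding bell_def by presburger+

lemma quiet_call: "quiet (call i)"
  using call_ch_bell[of i] by (auto simp: quiet_def call_def)

lemma quiet_set_reg: "star_free K \<Longrightarrow> quiet (set_reg r U K)"
  by (auto simp: quiet_def set_reg_def)

lemma quiet_test_reg: "star_free K \<Longrightarrow> star_free K' \<Longrightarrow> quiet (test_reg r K K')"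
  by (auto simp: quiet_def test_reg_def)

lemma quiet_proc: "quiet K \<Longrightarrow> quiet (proc c K l)"
  by (induction c arbitrary: K l) (auto intro: quiet_set_reg quiet_call quiet_star_free)

lemma quiet_loops: "quiet K \<Longrightarrow> B \<in> set (loops c K l) \<Longrightarrow> quiet B"
proof (induction c arbitrary: K l)
  case (Seq c c')
  from Seq.prems(2) consider "B \<in> set (loops c (proc c' K (l + num_loops c)) l)"
    | "B \<in> set (loops c' K (l + num_loops c))" by auto
  then show ?case
    by cases (auto intro: Seq.IH(1)[OF quiet_proc[OF Seq.prems(1)]] Seq.IH(2)[OF Seq.prems(1)])
next
  case (Loop r c)
  from Loop.prems(2) consider
      "B = test_reg r (proc c (call l) (Suc l)) (set_reg r (numeral_proc r 0) K)"
    | "B \<in> set (loops c (call l) (Suc l))" by auto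
  then show ?case
  proof cases
    case 1
    then show ?thesis using Loop.prems(1)
      by (simp add: quiet_test_reg quiet_set_reg quiet_proc quiet_call quiet_star_free)
  next
    case 2
    then show ?thesis by (rule Loop.IH[OF quiet_call])
  qed
qed simp_all

section \<open>Registers and servers as an inert environment\<close>

definition regs :: "(nat \<Rightarrow> trm) \<Rightarrow> nat \<Rightarrow> trm multiset" where
  "regs q N = image_mset (\<lambda>r. Loc r (q r)) (mset_set {..<N})"

definition servers :: "trm list \<Rightarrow> trm multiset" where
  "servers Bs = image_mset (\<lambda>i. server i (Bs ! i)) (mset_set {..<length Bs})"

definition env :: "(nat \<Rightarrow> trm) \<Rightarrow> nat \<Rightarrow> trm list \<Rightarrow> trm multiset" where
  "env q N Bs = regs q N + servers Bs"

text \<open>The case \<open>Nil_proc\<close> covers the moment between a successful zero test and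
  the restoration of the register. For the same reason \<open>env\<close> is given contents rather
  than numbers.\<close>

definition content :: "nat \<Rightarrow> trm \<Rightarrow> bool" where
  "content r Q \<longleftrightarrow> star_free Q \<and>
     (Q = Nil_proc \<or> (\<exists>x Q'. (x = unit_ch r \<or> x = zero_ch r) \<and> Q = Choice [(Out x, Q')]))"

definition valid_env :: "(nat \<Rightarrow> trm) \<Rightarrow> nat \<Rightarrow> trm list \<Rightarrow> bool" where
  "valid_env q N Bs \<longleftrightarrow> (\<forall>r<N. content r (q r)) \<and> (\<forall>B\<in>set Bs. quiet B)"

lemma content_numeral: "content r (numeral_proc r n)"
  by (cases n) (auto simp: content_def)

lemma regs_upd:
  assumes "r < N" "regs q N = add_mset (Loc r (q r)) L"
  shows "regs (q(r := Q)) N = add_mset (Loc r Q) L"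
proof -
  have "mset_set {..<N} = add_mset r (mset_set ({..<N} - {r}))"
    using assms(1) by (intro mset_set.remove) auto
  moreover have "image_mset (\<lambda>i. Loc i ((q(r := Q)) i)) (mset_set ({..<N} - {r})) =
      image_mset (\<lambda>i. Loc i (q i)) (mset_set ({..<N} - {r}))"
    by (intro image_mset_cong) auto
  ultimately show ?thesis using assms(2) by (simp add: regs_def)
qed

lemma env_split:
  assumes "r < N"
  obtains L where "env q N Bs = add_mset (Loc r (q r)) L"
    "\<And>Q. env (q(r := Q)) N Bs = add_mset (Loc r Q) L"
proof -
  from assms have "Loc r (q r) \<in># regs q N" by (auto simp: regs_def)
  then obtain L where L: "regs q N = add_mset (Loc r (q r)) L" by (metis mset_add)
  show thesis
    by (rule that[of "L + servers Bs"]) (use regs_upd[OF assms L] L in \<open>auto simp: env_def\<close>)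
qed

lemma server_in_env: "i < length Bs \<Longrightarrow> server i (Bs ! i) \<in># env q N Bs"
  by (auto simp: env_def servers_def)

inductive_cases trans_ChoiceE: "static_trans (Choice xs) \<alpha> P"
inductive_cases trans_RepE: "static_trans (Rep \<pi> Q) \<alpha> P"
inductive_cases trans_LocE: "static_trans (Loc a Q) \<alpha> P"

inductive env_trans :: "(nat \<Rightarrow> trm) \<Rightarrow> nat \<Rightarrow> trm list \<Rightarrow> trm \<Rightarrow> label \<Rightarrow> trm \<Rightarrow> bool"
  for q N Bs where
  emit: "r < N \<Longrightarrow> env_trans q N Bs (Loc r (q r)) (LLoc r (q r)) Star"
| out: "r < N \<Longrightarrow> x = unit_ch r \<or> x = zero_ch r \<Longrightarrow> q r = Choice [(Out x, Q)] \<Longrightarrow>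
     env_trans q N Bs (Loc r (q r)) (LOut x) (Loc r Q)"
| serve: "i < length Bs \<Longrightarrow>
     env_trans q N Bs (server i (Bs ! i)) (LIn (call_ch i)) (Par (Bs ! i) (server i (Bs ! i)))"

lemma env_transI:
  assumes "t \<in># env q N Bs" "valid_env q N Bs" "static_trans t \<alpha> t'"
  shows "env_trans q N Bs t \<alpha> t'"
proof -
  from assms(1) consider r where "r < N" "t = Loc r (q r)"
    | i where "i < length Bs" "t = server i (Bs ! i)"
    by (auto simp: env_def regs_def servers_def)
  then show ?thesis
  proof cases
    case 1
    from assms(2) 1(1) have c: "content r (q r)" by (simp add: valid_env_def)
    from assms(3)[unfolded 1(2)] show ?thesis
    proof (rule trans_LocE)
      assume "\<alpha> = LLoc r (q r)" "t' = Star"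
      with 1 show ?thesis by (auto intro: emit)
    next
      fix Q' assume Q': "t' = Loc r Q'" "static_trans (q r) \<alpha> Q'"
      with c obtain x Q where x: "x = unit_ch r \<or> x = zero_ch r" "q r = Choice [(Out x, Q)]"
        by (auto simp: content_def elim!: trans_ChoiceE)
      with Q' have "\<alpha> = LOut x" "Q' = Q" by (auto elim: trans_ChoiceE)
      with 1 x Q' out[where q = q, OF 1(1) x] show ?thesis by simp
    qed
  next
    case 2
    with assms(3) serve[OF 2(1)] show ?thesis by (auto simp: server_def elim: trans_RepE)
  qed
qed

lemma env_trans_labels:
  assumes "env_trans q N Bs t \<alpha> t'"
  shows "(\<exists>i. \<alpha> = LIn (call_ch i)) \<or> (\<exists>r. \<alpha> = LOut (unit_ch r) \<or> \<alpha> = LOut (zero_ch r)) \<or>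
    (\<exists>a R. \<alpha> = LLoc a R)"
  using assms by cases auto

lemma env_trans_silent:
  assumes "env_trans q N Bs t \<alpha> t'" shows "\<alpha> \<noteq> LTau" "\<alpha> \<noteq> LOut bell"
  using env_trans_labels[OF assms] reg_ch_bell reg_ch_bell[THEN not_sym] by auto

lemma call_ch_neq: "call_ch i \<noteq> unit_ch r" "call_ch i \<noteq> zero_ch r"
  by presburger+

text \<open>The environment's inputs are on call channels and its outputs on register channels, and
  it has no update to meet an emitted register.\<close>

lemma env_trans_no_react:
  assumes "env_trans q N Bs t \<alpha> t'" "env_trans q N Bs u \<beta> u'"
  shows "\<not> react \<alpha> \<beta> x"
proof
  assume "react \<alpha> \<beta> x"
  then show False
    using env_trans_labels[OF assms(1)] env_trans_labels[OF assms(2)] call_ch_neq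
    by cases (auto dest: sym)
qed

lemma env_stuck:
  assumes "valid_env q N Bs" shows "\<not> mred (env q N Bs) M"
proof
  assume "mred (env q N Bs) M"
  then show False
  proof cases
    case (mred_tau t t' L)
    then show ?thesis using env_transI[OF _ assms mred_tau(3)] env_trans_silent by fastforce
  next
    case (mred_react t \<alpha> t' u \<beta> u' x L)
    then show ?thesis
      using env_transI[OF _ assms mred_react(3)] env_transI[OF _ assms mred_react(4)]
        env_trans_no_react by fastforce
  qed
qed

lemma env_silent: "valid_env q N Bs \<Longrightarrow> silent (env q N Bs)"
  unfolding silent_def
proof (intro ballI conjI allI notI)
  fix t assume v: "valid_env q N Bs" and t: "t \<in># env q N Bs"
  from t v show "star_free t"
    by (auto simp: env_def regs_def servers_def server_def valid_env_def content_def quiet_def)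
  fix t' assume "static_trans t (LOut bell) t'"
  then show False using env_transI[OF t v] env_trans_silent(2) by blast
qed

lemma silent_with_quiet:
  assumes "valid_env q N Bs" "quiet K" shows "silent (add_mset K (env q N Bs))"
proof -
  from assms(2) obtain xs where K: "K = Choice xs" "\<forall>P. (Out bell, P) \<notin> set xs"
    by (auto simp: quiet_def)
  have "\<not> static_trans K (LOut bell) t'" for t'
  proof
    assume "static_trans K (LOut bell) t'"
    then obtain \<pi> where "LOut bell = label_of \<pi>" "(\<pi>, t') \<in> set xs"
      unfolding K(1) by (auto elim: trans_ChoiceE)
    with K(2) show False by (cases \<pi>) auto
  qed
  with env_silent[OF assms(1)] quiet_star_free[OF assms(2)] show ?thesis
    by (auto simp: silent_def)
qed

section \<open>Reductions between the environment and a control thread\<close>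

inductive env_red :: "(nat \<Rightarrow> trm) \<Rightarrow> nat \<Rightarrow> trm list \<Rightarrow> (prefix \<times> trm) list \<Rightarrow> trm multiset \<Rightarrow> bool"
  for q N Bs xs where
  env_call: "(Out (call_ch i), K) \<in> set xs \<Longrightarrow> i < length Bs \<Longrightarrow>
     env_red q N Bs xs (env q N Bs + threads (Bs ! i) + threads K)"
| env_test: "(In x, K) \<in> set xs \<Longrightarrow> r < N \<Longrightarrow> x = unit_ch r \<or> x = zero_ch r \<Longrightarrow>
     q r = Choice [(Out x, Q)] \<Longrightarrow> env_red q N Bs xs (env (q(r := Q)) N Bs + threads K)"
| env_update: "(Upd r (Par (Loc r U) Nil_proc), K) \<in> set xs \<Longrightarrow> r < N \<Longrightarrow>
     static_cond r (Par (Loc r U) Nil_proc) (q r) \<Longrightarrow>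
     env_red q N Bs xs (env (q(r := fill U (q r))) N Bs + threads K)"

lemma env_red_mred:
  assumes "env_red q N Bs xs M" "valid_env q N Bs"
  shows "mred (add_mset (Choice xs) (env q N Bs)) M"
  using assms(1)
proof cases
  case (env_call i K)
  let ?t = "server i (Bs ! i)"
  obtain L where L: "env q N Bs = add_mset ?t L"
    using server_in_env[OF env_call(3)] by (metis mset_add)
  have "static_trans ?t (LIn (call_ch i)) (Par (Bs ! i) ?t)"
    unfolding server_def using static_trans.intros(3)[of "In (call_ch i)"] by simp
  moreover have "static_trans (Choice xs) (LOut (call_ch i)) K"
    using static_trans.intros(2)[OF env_call(2)] by simp
  ultimately have "mred (add_mset ?t (add_mset (Choice xs) L))
      (L + threads (plug (Par (Bs ! i) ?t) None) + threads K)"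
    by (rule mred_react) (rule react.intros)
  then show ?thesis unfolding env_call(1) L by (simp add: add_mset_commute server_def ac_simps)
next
  case (env_test x K r Q)
  obtain L where L: "env q N Bs = add_mset (Loc r (q r)) L"
    "\<And>Q. env (q(r := Q)) N Bs = add_mset (Loc r Q) L" using env_split[OF env_test(3)] by blast
  have "static_trans (Choice xs) (LIn x) K"
    using static_trans.intros(2)[OF env_test(2)] by simp
  moreover have "static_trans (Loc r (q r)) (LOut x) (Loc r Q)"
    unfolding env_test(5) using static_trans.intros(2)[of "Out x" Q "[(Out x, Q)]"]
    by (intro static_trans.intros(4)) simp
  ultimately have "mred (add_mset (Choice xs) (add_mset (Loc r (q r)) L))
      (L + threads (plug K None) + threads (Loc r Q))"
    by (rule mred_react) (rule react.intros)
  then show ?thesis unfolding env_test(1) L by simp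
next
  case (env_update r U K)
  let ?U = "Par (Loc r U) Nil_proc"
  obtain L where L: "env q N Bs = add_mset (Loc r (q r)) L"
    "\<And>Q. env (q(r := Q)) N Bs = add_mset (Loc r Q) L" using env_split[OF env_update(3)] by blast
  have "static_trans (Choice xs) (LUpd r ?U) K"
    using static_trans.intros(2)[OF env_update(2)] by simp
  from mred_react[OF static_trans.intros(1) this react.intros(2)[OF env_update(4)]]
  have "mred (add_mset (Loc r (q r)) (add_mset (Choice xs) L))
      (L + threads (plug Star (Some (fill ?U (q r)))) + threads K)" .
  then show ?thesis unfolding env_update(1) L by (simp add: add_mset_commute)
qed

definition simple_updates :: "(prefix \<times> trm) list \<Rightarrow> bool" where
  "simple_updates xs \<longleftrightarrow>
     (\<forall>r V K. (Upd r V, K) \<in> set xs \<longrightarrow> (\<exists>U. V = Par (Loc r U) Nil_proc))"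

text \<open>Since the environment is inert, \<open>Choice xs\<close> takes part in every reduction,
  and its partner makes one of the moves listed in \<open>env_trans\<close>.\<close>

lemma mred_env_red:
  assumes "mred (add_mset (Choice xs) (env q N Bs)) M" "valid_env q N Bs" "simple_updates xs"
  shows "env_red q N Bs xs M"
  using assms(1)
proof cases
  case (mred_tau t t' L)
  have "t \<notin># env q N Bs"
    using env_transI[OF _ assms(2) mred_tau(3)] env_trans_silent by blast
  moreover have "t \<in># add_mset (Choice xs) (env q N Bs)" by (simp add: mred_tau(1))
  ultimately have t: "t = Choice xs" by simp
  then obtain \<pi> where "LTau = label_of \<pi>" using mred_tau(3) by (auto elim: trans_ChoiceE)
  then show ?thesis by (cases \<pi>) auto
next
  case (mred_react t \<alpha> t' u \<beta> u' x L)
  have "\<not> (t \<in># env q N Bs \<and> u \<in># env q N Bs)"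
    using env_transI[OF _ assms(2) mred_react(3)] env_transI[OF _ assms(2) mred_react(4)]
      env_trans_no_react mred_react(5) by blast
  with mred_react(1) consider "t = Choice xs" "env q N Bs = add_mset u L"
    | "u = Choice xs" "env q N Bs = add_mset t L"
    by (auto simp: add_eq_conv_ex)
  then show ?thesis
  proof cases
    case 1
    then obtain \<pi> where \<pi>: "\<alpha> = label_of \<pi>" "(\<pi>, t') \<in> set xs"
      using mred_react(3) by (auto elim: trans_ChoiceE)
    have u: "env_trans q N Bs u \<beta> u'" by (rule env_transI[OF _ assms(2) mred_react(4)]) (simp add: 1)
    from mred_react(5) show ?thesis
    proof cases
      case r: (1 a)
      with \<pi> have a: "(In a, t') \<in> set xs" by (cases \<pi>) auto
      from u r obtain r Q where Q: "r < N" "a = unit_ch r \<or> a = zero_ch r" "u = Loc r (q r)"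
        "q r = Choice [(Out a, Q)]" "u' = Loc r Q" by (auto elim: env_trans.cases)
      obtain L' where "env q N Bs = add_mset u L'"
        "env (q(r := Q)) N Bs = add_mset u' L'" using env_split[OF Q(1)] Q(3,5) by metis
      with 1(2) mred_react(2) r have "M = env (q(r := Q)) N Bs + threads t'"
        by (simp add: Q(5))
      with env_test[where q = q, OF a Q(1,2,4)] show ?thesis by simp
    next
      case (2 a U R)
      with \<pi> show ?thesis by (cases \<pi>) auto
    qed
  next
    case 2
    then obtain \<pi> where \<pi>: "\<beta> = label_of \<pi>" "(\<pi>, u') \<in> set xs"
      using mred_react(4) by (auto elim: trans_ChoiceE)
    have t: "env_trans q N Bs t \<alpha> t'" by (rule env_transI[OF _ assms(2) mred_react(3)]) (simp add: 2)
    from mred_react(5) show ?thesis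
    proof cases
      case r: (1 a)
      with \<pi> have a: "(Out a, u') \<in> set xs" by (cases \<pi>) auto
      from t r obtain i where i: "i < length Bs" "a = call_ch i" "t = server i (Bs ! i)"
        "t' = Par (Bs ! i) t" by (auto elim: env_trans.cases)
      with 2(2) mred_react(2) r have "M = env q N Bs + threads (Bs ! i) + threads u'"
        by (simp add: server_def ac_simps)
      with env_call[OF a[unfolded i(2)] i(1)] show ?thesis by simp
    next
      case r: (2 a V R)
      with \<pi> have "(Upd a V, u') \<in> set xs" by (cases \<pi>) auto
      with assms(3) obtain U where U: "V = Par (Loc a U) Nil_proc"
        "(Upd a (Par (Loc a U) Nil_proc), u') \<in> set xs" by (auto simp: simple_updates_def)
      from t r have R: "a < N" "t = Loc a (q a)" "R = q a" "t' = Star"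
        by (auto elim: env_trans.cases)
      obtain L' where "env q N Bs = add_mset t L'"
        "\<And>Q. env (q(a := Q)) N Bs = add_mset (Loc a Q) L'" using env_split[OF R(1)] R(2) by metis
      with 2(2) mred_react(2) r have "M = env (q(a := fill U (q a))) N Bs + threads u'"
        by (simp add: R U)
      with env_update[OF U(2) R(1)] r show ?thesis by (simp add: R U)
    qed
  qed
qed

lemma det_step_env:
  assumes "valid_env q N Bs" "quiet (Choice xs)" "simple_updates xs"
    and "env_red q N Bs xs M" "\<And>M'. env_red q N Bs xs M' \<Longrightarrow> M' = M"
  shows "det_step (add_mset (Choice xs) (env q N Bs)) M"
  unfolding det_step_def
  using silent_with_quiet[OF assms(1,2)] env_red_mred[OF assms(4,1)] mred_env_red[OF _ assms(1,3)]
    assms(5) by blast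

lemma det_run_call:
  assumes "valid_env q N Bs" "i < length Bs"
  shows "det_step\<^sup>*\<^sup>* (add_mset (call i) (env q N Bs)) (add_mset (Bs ! i) (env q N Bs))"
proof -
  let ?xs = "[(Out (call_ch i), Nil_proc)]"
  let ?M = "env q N Bs + threads (Bs ! i) + threads Nil_proc"
  have red: "env_red q N Bs ?xs ?M" by (rule env_call) (use assms(2) in auto)
  have unique: "M = ?M" if "env_red q N Bs ?xs M" for M
    using that
  proof cases
    case (env_call i' K)
    then have "i' = i" "K = Nil_proc" by simp_all
    with env_call(1) show ?thesis by (simp only:)
  qed simp_all
  have "simple_updates ?xs" by (simp add: simple_updates_def)
  from det_step_env[OF assms(1) quiet_call[unfolded call_def] this red unique]
  have "det_step (add_mset (call i) (env q N Bs)) ?M" by (simp only: call_def)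
  moreover have "quiet (Bs ! i)" using assms by (simp add: valid_env_def)
  ultimately show ?thesis by (simp add: threads_quiet r_into_rtranclp)
qed

lemma det_run_test:
  assumes "valid_env q N Bs" "r < N" "star_free K" "star_free K'"
    and "(q r = Choice [(Out (unit_ch r), Q)] \<and> J = K) \<or> (q r = Choice [(Out (zero_ch r), Q)] \<and> J = K')"
  shows "det_step\<^sup>*\<^sup>* (add_mset (test_reg r K K') (env q N Bs)) (env (q(r := Q)) N Bs + threads J)"
proof -
  let ?xs = "[(In (unit_ch r), K), (In (zero_ch r), K')]"
  let ?M = "env (q(r := Q)) N Bs + threads J"
  from assms(5) have red: "env_red q N Bs ?xs ?M"
  proof (elim disjE conjE)
    assume "q r = Choice [(Out (unit_ch r), Q)]" "J = K"
    then show ?thesis using assms(2) by (intro env_test[where x = "unit_ch r"]) simp_all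
  next
    assume "q r = Choice [(Out (zero_ch r), Q)]" "J = K'"
    then show ?thesis using assms(2) by (intro env_test[where x = "zero_ch r"]) simp_all
  qed
  have unique: "M = ?M" if "env_red q N Bs ?xs M" for M
    using that
  proof cases
    case (env_test x J' r' Q')
    from env_test(2) have x: "x = unit_ch r \<and> J' = K \<or> x = zero_ch r \<and> J' = K'" by auto
    then have "x = unit_ch r \<or> x = zero_ch r" by blast
    \<comment> \<open>The channel \<open>x\<close> alone determines the register, whichever of the
      two kinds it is.\<close>
    with env_test(4) have r: "r' = r" by presburger
    from x assms(5) env_test(5) have "Q' = Q \<and> J' = J" unfolding r by auto
    then show ?thesis unfolding env_test(1) r by (simp only:)
  qed simp_all
  have "simple_updates ?xs" by (simp add: simple_updates_def)
  from det_step_env[OF assms(1) quiet_test_reg[OF assms(3,4), unfolded test_reg_def] this red unique]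
  show ?thesis unfolding test_reg_def by (rule r_into_rtranclp)
qed

lemma det_run_set_reg:
  assumes "valid_env q N Bs" "r < N" "quiet K" "static_cond r (Par (Loc r U) Nil_proc) (q r)"
  shows "det_step\<^sup>*\<^sup>* (add_mset (set_reg r U K) (env q N Bs))
    (add_mset K (env (q(r := fill U (q r))) N Bs))"
proof -
  let ?xs = "[(Upd r (Par (Loc r U) Nil_proc), K)]"
  let ?M = "env (q(r := fill U (q r))) N Bs + threads K"
  have red: "env_red q N Bs ?xs ?M" by (rule env_update) (use assms in auto)
  have unique: "M = ?M" if "env_red q N Bs ?xs M" for M
    using that by cases simp_all
  have "simple_updates ?xs" by (simp add: simple_updates_def)
  from det_step_env[OF assms(1) quiet_set_reg[OF quiet_star_free[OF assms(3)], unfolded set_reg_def]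
      this red unique]
  have "det_step (add_mset (set_reg r U K) (env q N Bs)) ?M" by (simp only: set_reg_def)
  with assms(3) show ?thesis by (simp add: threads_quiet r_into_rtranclp)
qed

text \<open>A sum hides what lies beneath its prefixes from \<open>CStr\<close> and
  \<open>numap\<close>: the containment structure is the same before and after, and
  \<open>numap\<close> of the old content is 0, as a hole under a prefix demands.\<close>

lemma static_cond_Choice: "static_cond r (Par (Loc r (Choice xs)) Nil_proc) (Choice ys)"
  by (simp add: static_cond_def CStr_def)

section \<open>Simulation of loop programs by deterministic runs\<close>

fun reg_bound :: "cmd \<Rightarrow> nat" where
  "reg_bound Skip = 0"
| "reg_bound (Inc r) = Suc r"
| "reg_bound (Seq c c') = max (reg_bound c) (reg_bound c')"
| "reg_bound (Loop r c) = max (Suc r) (reg_bound c)"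

abbreviation num_env :: "(nat \<Rightarrow> nat) \<Rightarrow> nat \<Rightarrow> trm list \<Rightarrow> trm multiset" where
  "num_env s N Bs \<equiv> env (\<lambda>r. numeral_proc r (s r)) N Bs"

lemma numeral_Choice: "\<exists>xs. numeral_proc r n = Choice xs"
  by (cases n) auto

lemma valid_env_upd: "valid_env q N Bs \<Longrightarrow> content r Q \<Longrightarrow> valid_env (q(r := Q)) N Bs"
  by (simp add: valid_env_def)

lemma num_env_upd:
  "num_env (s(r := n)) N Bs = env ((\<lambda>r. numeral_proc r (s r))(r := numeral_proc r n)) N Bs"
  by (rule arg_cong[where f = "\<lambda>q. env q N Bs"]) auto

lemma valid_num_env: "\<forall>B\<in>set Bs. quiet B \<Longrightarrow> valid_env (\<lambda>r. numeral_proc r (s r)) N Bs"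
  by (simp add: valid_env_def content_numeral)

text \<open>By induction on the execution. \<open>pre\<close> and \<open>post\<close> place the
  servers of \<open>c\<close> at the positions from \<open>l\<close> on in the global list, so that
  each numbered call finds its body.\<close>

lemma det_run_proc:
  assumes "exec c s s'" "reg_bound c \<le> N" "quiet K" "\<forall>B\<in>set Bs. quiet B"
    "Bs = pre @ loops c K l @ post" "length pre = l"
  shows "det_step\<^sup>*\<^sup>* (add_mset (proc c K l) (num_env s N Bs)) (add_mset K (num_env s' N Bs))"
  using assms
proof (induction arbitrary: K l pre post rule: exec.induct)
  case (exec_Skip s)
  then show ?case by simp
next
  case (exec_Inc r s)
  let ?q = "\<lambda>r. numeral_proc r (s r)"
  obtain xs where "numeral_proc r (s r) = Choice xs" using numeral_Choice by blast
  then have "static_cond r (Par (Loc r (Choice [(Out (unit_ch r), Hole)])) Nil_proc) (?q r)"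
    by (simp only: static_cond_Choice)
  \<comment> \<open>Filling the hole puts the old numeral under one more unit output, which is the
    numeral of the successor.\<close>
  from det_run_set_reg[where q = ?q, OF valid_num_env[OF exec_Inc(3)] _ exec_Inc(2) this, of N] exec_Inc(1)
  show ?case unfolding num_env_upd by simp
next
  case (exec_Seq c s t c' u)
  let ?K = "proc c' K (l + num_loops c)"
  have "det_step\<^sup>*\<^sup>* (add_mset (proc c ?K l) (num_env s N Bs)) (add_mset ?K (num_env t N Bs))"
    by (rule exec_Seq.IH(1)[where pre = pre and post = "loops c' K (l + num_loops c) @ post"])
      (use exec_Seq.prems in \<open>auto intro: quiet_proc\<close>)
  also have "det_step\<^sup>*\<^sup>* (add_mset ?K (num_env t N Bs)) (add_mset K (num_env u N Bs))"
    by (rule exec_Seq.IH(2)[where pre = "pre @ loops c ?K l" and post = post])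
      (use exec_Seq.prems in auto)
  finally show ?case by simp
next
  case (exec_Loop_0 s r c)
  let ?q = "\<lambda>r. numeral_proc r (s r)" and ?K = "set_reg r (numeral_proc r 0) K"
  let ?B = "test_reg r (proc c (call l) (Suc l)) ?K"
  have v: "valid_env ?q N Bs" using exec_Loop_0.prems(3) by (rule valid_num_env)
  have v': "valid_env (?q(r := Nil_proc)) N Bs"
    by (rule valid_env_upd[OF v]) (simp add: content_def)
  have l: "l < length Bs" "Bs ! l = ?B" using exec_Loop_0.prems(4,5) by (simp_all add: nth_append)
  have r: "r < N" using exec_Loop_0.prems(1) by simp
  have K: "quiet ?K" "star_free (proc c (call l) (Suc l))"
    using exec_Loop_0.prems(2) by (simp_all add: quiet_set_reg quiet_star_free quiet_proc quiet_call)
  have "det_step\<^sup>*\<^sup>* (add_mset (call l) (num_env s N Bs)) (add_mset ?B (num_env s N Bs))"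
    using det_run_call[OF v l(1)] by (simp add: l(2))
  also have "det_step\<^sup>*\<^sup>* (add_mset ?B (num_env s N Bs)) (env (?q(r := Nil_proc)) N Bs + threads ?K)"
    by (rule det_run_test[OF v r K(2) quiet_star_free[OF K(1)]]) (simp add: exec_Loop_0.hyps)
  also have "env (?q(r := Nil_proc)) N Bs + threads ?K = add_mset ?K (env (?q(r := Nil_proc)) N Bs)"
    unfolding threads_quiet[OF K(1)] by simp
  also have "det_step\<^sup>*\<^sup>* (add_mset ?K (env (?q(r := Nil_proc)) N Bs)) (add_mset K (num_env s N Bs))"
  proof -
    have "static_cond r (Par (Loc r (numeral_proc r 0)) Nil_proc) ((?q(r := Nil_proc)) r)"
      by (simp add: static_cond_Choice)
    note det_run_set_reg[OF v' r exec_Loop_0.prems(2) this]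
    \<comment> \<open>The restoring pattern has no hole, so filling it yields the zero numeral
      whatever the content.\<close>
    moreover have "(?q(r := Nil_proc))(r := fill (numeral_proc r 0) ((?q(r := Nil_proc)) r)) = ?q"
      by (rule ext) (simp add: exec_Loop_0.hyps)
    ultimately show ?thesis by (simp only:)
  qed
  finally show ?case by simp
next
  case (exec_Loop_Suc s r n c t u)
  let ?q = "\<lambda>r. numeral_proc r (s r)" and ?C = "proc c (call l) (Suc l)"
  let ?B = "test_reg r ?C (set_reg r (numeral_proc r 0) K)"
  have v: "valid_env ?q N Bs" using exec_Loop_Suc.prems(3) by (rule valid_num_env)
  have l: "l < length Bs" "Bs ! l = ?B" using exec_Loop_Suc.prems(4,5) by (simp_all add: nth_append)
  have r: "r < N" using exec_Loop_Suc.prems(1) by simp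
  have K: "star_free (set_reg r (numeral_proc r 0) K)" "quiet ?C"
    using exec_Loop_Suc.prems(2) by (simp_all add: quiet_set_reg quiet_star_free quiet_proc quiet_call)
  have "det_step\<^sup>*\<^sup>* (add_mset (call l) (num_env s N Bs)) (add_mset ?B (num_env s N Bs))"
    using det_run_call[OF v l(1)] by (simp add: l(2))
  also have "det_step\<^sup>*\<^sup>* (add_mset ?B (num_env s N Bs)) (env (?q(r := numeral_proc r n)) N Bs + threads ?C)"
    by (rule det_run_test[OF v r quiet_star_free[OF K(2)] K(1)]) (simp add: exec_Loop_Suc.hyps)
  also have "env (?q(r := numeral_proc r n)) N Bs + threads ?C =
      add_mset ?C (num_env (s(r := n)) N Bs)"
    unfolding threads_quiet[OF K(2)] num_env_upd by simp
  \<comment> \<open>Number \<open>l\<close> belongs to the loop itself, so the servers of its body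
    start at \<open>Suc l\<close>; the body continues by calling server \<open>l\<close>
    again.\<close>
  also have "det_step\<^sup>*\<^sup>* (add_mset ?C (num_env (s(r := n)) N Bs)) (add_mset (call l) (num_env t N Bs))"
    by (rule exec_Loop_Suc.IH(1)[where pre = "pre @ [?B]" and post = post])
      (use exec_Loop_Suc.prems in \<open>auto intro: quiet_call\<close>)
  also have "det_step\<^sup>*\<^sup>* (add_mset (call l) (num_env t N Bs)) (add_mset K (num_env u N Bs))"
    using exec_Loop_Suc.IH(2)[OF exec_Loop_Suc.prems] by simp
  finally show ?case by simp
qed

section \<open>The verdict and the complete machine\<close>

definition spin :: name where "spin = 7"

definition ticker :: trm where "ticker = Choice [(Out spin, Nil_proc)]"

text \<open>Each communication on \<open>spin\<close> uses up one \<open>ticker\<close> and releases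
  another, which supplies an infinite computation while the \<open>bell\<close> output stays
  available.\<close>

definition ring :: trm where
  "ring = Par (Choice [(Out bell, Nil_proc)]) (Par (Rep (In spin) ticker) ticker)"

definition verdict :: trm where "verdict = test_reg 1 ring Nil_proc"

lemma star_free_ring: "star_free ring"
  by (simp add: ring_def ticker_def)

lemma quiet_verdict: "quiet verdict"
  unfolding verdict_def by (rule quiet_test_reg) (simp_all add: star_free_ring)

text \<open>One communication on \<open>spin\<close> restores the same multiset of threads, so
  choosing such a successor can be iterated for ever.\<close>

lemma barb_omega_ring:
  assumes "static_red\<^sup>*\<^sup>* P P'" "threads P' = N + threads ring" "\<And>t. t \<in># N \<Longrightarrow> star_free t"
  shows "barb_omega P (BOut bell)"
proof -
  let ?M = "N + threads ring"
  have sf: "star_free Q" if "threads Q = ?M" for Q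
    using that assms(3) star_free_ring star_free_threads[of Q] star_free_threads[of ring] by auto
  have barb: "has_barb Q (BOut bell)" if "threads Q = ?M" for Q
  proof -
    let ?t = "Choice [(Out bell, Nil_proc)]"
    have "threads Q = add_mset ?t (N + threads (Par (Rep (In spin) ticker) ticker))"
      by (simp add: that ring_def)
    moreover have "static_trans ?t (LOut bell) Nil_proc"
      using static_trans.intros(2)[of "Out bell" Nil_proc "[(Out bell, Nil_proc)]"] by simp
    ultimately show ?thesis using thread_lift unfolding has_barb_def by fastforce
  qed
  have "\<exists>Q'. static_red Q Q' \<and> threads Q' = ?M" if Q: "threads Q = ?M" for Q
  proof -
    let ?t = "Rep (In spin) ticker" and ?L = "add_mset (Choice [(Out bell, Nil_proc)]) N"
    have "static_trans ?t (LIn spin) (Par ticker ?t)"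
      using static_trans.intros(3)[of "In spin" ticker] by simp
    moreover have "static_trans ticker (LOut spin) Nil_proc"
      using static_trans.intros(2)[of "Out spin" Nil_proc "[(Out spin, Nil_proc)]"]
      by (simp add: ticker_def)
    ultimately have "mred (add_mset ?t (add_mset ticker ?L))
        (?L + threads (plug (Par ticker ?t) None) + threads Nil_proc)"
      by (rule mred_react) (rule react.intros)
    then have "mred (threads Q) ?M"
      unfolding Q by (simp add: ring_def ticker_def add_mset_commute)
    from mred_static_red[OF this sf[OF Q]] show ?thesis .
  qed
  then obtain next_state where step: "\<And>Q. threads Q = ?M \<Longrightarrow> static_red Q (next_state Q)"
    "\<And>Q. threads Q = ?M \<Longrightarrow> threads (next_state Q) = ?M" by metis
  \<comment> \<open>Computations are indexed from 1, hence the shift.\<close>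
  define R where "R i = (next_state ^^ (i - 1)) P'" for i
  have R: "threads (R i) = ?M" for i
  proof -
    have "threads ((next_state ^^ k) P') = ?M" for k
      by (induction k) (simp_all add: assms(2) step(2))
    then show ?thesis by (simp add: R_def)
  qed
  have "R (i + 1) = next_state (R i)" if "i \<ge> 1" for i
    using that by (cases i) (simp_all add: R_def)
  then have "static_red (R i) (R (i + 1))" if "i \<ge> 1" for i
    using that step(1)[OF R] by simp
  moreover have "static_red\<^sup>*\<^sup>* P (R 1)" using assms(1) by (simp add: R_def)
  ultimately show ?thesis using barb[OF R] unfolding barb_omega_def by blast
qed

text \<open>Kept apart from \<open>machine\<close>, so that the code of their composition is
  computable from the code of the machine and \<open>n\<close>.\<close>

definition input :: "nat \<Rightarrow> trm" where
  "input n = Loc 0 (numeral_proc 0 n)"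

text \<open>\<open>max 2\<close> secures registers 0 and 1, for input and answer, even if
  \<open>c\<close> does not mention them. Register 0 is left out because \<open>input\<close>
  supplies it.\<close>

definition machine :: "cmd \<Rightarrow> trm" where
  "machine c =
     (let N = max 2 (reg_bound c); Bs = loops c verdict 0 in
      foldr Par (map (\<lambda>r. Loc r (numeral_proc r 0)) [1..<N] @
        map (\<lambda>i. server i (Bs ! i)) [0..<length Bs] @ [proc c verdict 0]) Nil_proc)"

lemma threads_foldr_Par:
  "\<forall>t\<in>set ts. threads t = {#t#} \<Longrightarrow> threads (foldr Par ts Nil_proc) = mset ts"
  by (induction ts) auto

lemma threads_machine:
  assumes "N = max 2 (reg_bound c)" "Bs = loops c verdict 0"
  shows "threads (Par (machine c) (input n)) =
    add_mset (proc c verdict 0) (num_env ((\<lambda>_. 0)(0 := n)) N Bs)"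
proof -
  let ?s = "(\<lambda>_. 0)(0 := n)"
  have "mset_set {..<N} = mset [0..<N]" by (simp add: atLeast0LessThan)
  also have "[0..<N] = 0 # [1..<N]" using assms(1) by (simp add: upt_conv_Cons)
  finally have "mset_set {..<N} = add_mset 0 (mset [1..<N])" by simp
  moreover have "image_mset (\<lambda>r. Loc r (numeral_proc r (?s r))) (mset [1..<N]) =
      image_mset (\<lambda>r. Loc r (numeral_proc r 0)) (mset [1..<N])"
    by (intro image_mset_cong) auto
  ultimately have regs: "regs (\<lambda>r. numeral_proc r (?s r)) N =
      add_mset (input n) (mset (map (\<lambda>r. Loc r (numeral_proc r 0)) [1..<N]))"
    by (simp add: regs_def input_def)
  have servers: "servers Bs = mset (map (\<lambda>i. server i (Bs ! i)) [0..<length Bs])"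
    by (simp add: servers_def atLeast0LessThan)
  have "threads (machine c) = mset (map (\<lambda>r. Loc r (numeral_proc r 0)) [1..<N] @
      map (\<lambda>i. server i (Bs ! i)) [0..<length Bs] @ [proc c verdict 0])"
    unfolding machine_def assms Let_def
    by (rule threads_foldr_Par) (auto simp: server_def threads_quiet quiet_proc quiet_verdict)
  then show ?thesis unfolding threads.simps env_def regs servers by (simp add: input_def)
qed

text \<open>The run of \<open>c\<close> ends in \<open>verdict\<close>. If the answer is zero, only
  the inert environment remains, and \<open>det_run_safe\<close> covers all reachable states;
  otherwise \<open>ring\<close> is reached, and a single computation suffices.\<close>

lemma machine_behaviour:
  assumes "exec c ((\<lambda>_. 0)(0 := n)) s"
  shows "if s 1 = 0 then \<forall>Q. static_red\<^sup>*\<^sup>* (Par (machine c) (input n)) Q \<longrightarrow> \<not> has_barb Q (BOut bell)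
    else barb_omega (Par (machine c) (input n)) (BOut bell)"
proof -
  define N where "N = max 2 (reg_bound c)"
  define Bs where "Bs = loops c verdict 0"
  let ?P = "Par (machine c) (input n)" and ?q = "\<lambda>r. numeral_proc r (s r)"
  have Bs: "\<forall>B\<in>set Bs. quiet B" using quiet_loops[OF quiet_verdict] by (auto simp: Bs_def)
  have v: "valid_env ?q N Bs" using Bs by (rule valid_num_env)
  have "det_step\<^sup>*\<^sup>* (threads ?P) (add_mset verdict (num_env s N Bs))"
    unfolding threads_machine[OF N_def Bs_def]
    by (rule det_run_proc[OF assms _ quiet_verdict Bs, where pre = "[]" and post = "[]"])
      (simp_all add: N_def Bs_def)
  also have "det_step\<^sup>*\<^sup>* (add_mset verdict (num_env s N Bs))
      (env (?q(1 := case s 1 of 0 \<Rightarrow> Nil_proc | Suc k \<Rightarrow> numeral_proc 1 k)) N Bs +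
       threads (case s 1 of 0 \<Rightarrow> Nil_proc | Suc k \<Rightarrow> ring))"
    unfolding verdict_def
    by (rule det_run_test[OF v]) (auto simp: N_def star_free_ring split: nat.splits)
  finally have run: "det_step\<^sup>*\<^sup>* (threads ?P)
      (env (?q(1 := case s 1 of 0 \<Rightarrow> Nil_proc | Suc k \<Rightarrow> numeral_proc 1 k)) N Bs +
       threads (case s 1 of 0 \<Rightarrow> Nil_proc | Suc k \<Rightarrow> ring))" .
  show ?thesis
  proof (cases "s 1")
    case 0
    let ?q' = "?q(1 := Nil_proc)"
    have v': "valid_env ?q' N Bs" by (rule valid_env_upd[OF v]) (simp add: content_def)
    have run': "det_step\<^sup>*\<^sup>* (threads ?P) (env ?q' N Bs)" using run 0 by simp
    show ?thesis
      using det_run_safe[OF run' env_silent[OF v'] env_stuck[OF v']] 0 by simp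
  next
    case (Suc k)
    let ?q' = "?q(1 := numeral_proc 1 k)"
    have v': "valid_env ?q' N Bs" by (rule valid_env_upd[OF v]) (rule content_numeral)
    have "det_step\<^sup>*\<^sup>* (threads ?P) (env ?q' N Bs + threads ring)" using run Suc by simp
    from det_run_reaches[OF this] obtain Q where
      "static_red\<^sup>*\<^sup>* ?P Q" "threads Q = env ?q' N Bs + threads ring" by blast
    then have "barb_omega ?P (BOut bell)"
      by (rule barb_omega_ring) (use env_silent[OF v'] in \<open>auto simp: silent_def\<close>)
    with Suc show ?thesis by simp
  qed
qed

section \<open>Membership in the static class\<close>

lemmas static_intros =
  static_proc_static_act_static_prefix_static_pattern_static_act_pattern.intros

lemma static_act_Nil: "static_act Nil_proc"
  by (rule static_intros) simp

lemma static_act_numeral: "static_act (numeral_proc r n)"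
  by (induction n) (auto intro!: static_intros(6) static_intros(8) static_act_Nil)

lemma static_act_pattern_Out: "static_act_pattern P \<Longrightarrow> static_act_pattern (Choice [(Out x, P)])"
  by (rule static_intros) (auto intro: static_intros)

lemma static_act_set_reg:
  "static_act_pattern U \<Longrightarrow> static_act K \<Longrightarrow> static_act (set_reg r U K)"
  unfolding set_reg_def
  by (rule static_intros) (auto intro!: static_intros(9) static_intros(13) static_act_Nil)

lemma static_act_test_reg: "static_act K \<Longrightarrow> static_act K' \<Longrightarrow> static_act (test_reg r K K')"
  unfolding test_reg_def by (rule static_intros) (auto intro: static_intros(7))

lemma static_act_call: "static_act (call i)"
  unfolding call_def by (rule static_intros) (auto intro: static_intros(8) static_act_Nil)

lemma static_act_proc: "static_act K \<Longrightarrow> static_act (proc c K l)"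
  by (induction c arbitrary: K l)
    (auto intro: static_act_set_reg static_act_call static_act_pattern_Out static_intros(14))

lemma static_act_pattern_numeral_0: "static_act_pattern (numeral_proc r 0)"
  using static_intros(17)[of "[]"] by (simp add: static_act_pattern_Out)

lemma static_act_loops: "static_act K \<Longrightarrow> B \<in> set (loops c K l) \<Longrightarrow> static_act B"
proof (induction c arbitrary: K l)
  case (Seq c c')
  from Seq.prems(2) consider "B \<in> set (loops c (proc c' K (l + num_loops c)) l)"
    | "B \<in> set (loops c' K (l + num_loops c))" by auto
  then show ?case
    by cases (auto intro: Seq.IH(1)[OF static_act_proc[OF Seq.prems(1)]] Seq.IH(2)[OF Seq.prems(1)])
next
  case (Loop r c)
  from Loop.prems(2) consider
      "B = test_reg r (proc c (call l) (Suc l)) (set_reg r (numeral_proc r 0) K)"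
    | "B \<in> set (loops c (call l) (Suc l))" by auto
  then show ?case
  proof cases
    case 1
    with Loop.prems(1) show ?thesis
      by (simp only: static_act_test_reg static_act_set_reg static_act_proc static_act_call
          static_act_pattern_numeral_0)
  next
    case 2
    then show ?thesis by (rule Loop.IH[OF static_act_call])
  qed
qed simp_all

lemma static_act_verdict: "static_act verdict"
proof -
  have out: "static_act (Choice [(Out x, Nil_proc)])" for x
    by (rule static_intros) (auto intro: static_intros(8) static_act_Nil)
  have "static_act ring"
    unfolding ring_def ticker_def by (intro static_intros(4,5,7) out)
  then show ?thesis unfolding verdict_def by (intro static_act_test_reg static_act_Nil)
qed

lemma static_machine: "Par (machine c) (input n) \<in> Es1"
proof -
  have fold: "static_proc (foldr Par ts Nil_proc)" if "\<forall>t\<in>set ts. static_proc t" for ts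
    using that by (induction ts) (auto intro: static_intros(2,3) static_act_Nil)
  have "static_proc (server i (loops c verdict 0 ! i))" if "i < num_loops c" for i
    using static_act_loops[OF static_act_verdict, of "loops c verdict 0 ! i" c 0] that
    unfolding server_def by (intro static_intros(3,5,7)) simp
  moreover have "static_proc (Loc r (numeral_proc r n))" for r n
    by (intro static_intros(1,3) static_act_numeral)
  moreover have "static_proc (proc c verdict 0)"
    by (intro static_intros(3) static_act_proc static_act_verdict)
  ultimately have "static_proc (machine c)"
    unfolding machine_def Let_def by (intro fold) (auto simp del: numeral_proc.simps)
  then show ?thesis
    unfolding Es1_def Es_def input_def by (auto intro: static_intros(1,2,3) static_act_numeral)
qed

section \<open>Computing codes of processes\<close>

definition rec_add :: recf where
  "rec_add = Prim (Proj 0) (Comp Succ [Proj 1])"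

definition rec_triangle :: recf where
  "rec_triangle = Prim Zero (Comp rec_add [Proj 1, Comp Succ [Proj 0]])"

text \<open>\<open>prod_encode (m, n)\<close> is \<open>triangle (m + n) + m\<close>.\<close>

definition rec_pair :: "recf \<Rightarrow> recf \<Rightarrow> recf" where
  "rec_pair f g = Comp rec_add [Comp rec_triangle [Comp rec_add [f, g]], f]"

fun rec_const :: "nat \<Rightarrow> recf" where
  "rec_const 0 = Zero"
| "rec_const (Suc n) = Comp Succ [rec_const n]"

lemma rec_eval_Proj: "i < length xs \<Longrightarrow> y = xs ! i \<Longrightarrow> rec_eval (Proj i) xs y"
  by (simp add: rec_eval.intros)

lemma rec_eval_Comp1: "rec_eval g xs y \<Longrightarrow> rec_eval f [y] z \<Longrightarrow> rec_eval (Comp f [g]) xs z"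
  by (rule rec_eval.intros(4)[where ys = "[y]"]) simp_all

lemma rec_eval_Comp2:
  "rec_eval g xs y \<Longrightarrow> rec_eval h xs z \<Longrightarrow> rec_eval f [y, z] w \<Longrightarrow> rec_eval (Comp f [g, h]) xs w"
  by (rule rec_eval.intros(4)[where ys = "[y, z]"]) simp_all

lemma rec_eval_Succ: "rec_eval g xs y \<Longrightarrow> rec_eval (Comp Succ [g]) xs (Suc y)"
  by (erule rec_eval_Comp1) (rule rec_eval.intros)

lemma rec_eval_const: "rec_eval (rec_const n) xs n"
  by (induction n) (auto intro: rec_eval.intros(1) rec_eval_Succ)

lemma rec_eval_add: "rec_eval rec_add [m, n] (m + n)"
  unfolding rec_add_def
proof (induction m)
  case 0
  then show ?case by (auto intro!: rec_eval.intros(5) rec_eval_Proj)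
next
  case (Suc m)
  show ?case unfolding add_Suc
    by (intro rec_eval.intros(6)[OF Suc] rec_eval_Succ rec_eval_Proj) simp_all
qed

lemma rec_eval_triangle: "rec_eval rec_triangle [n] (triangle n)"
  unfolding rec_triangle_def
proof (induction n)
  case 0
  then show ?case by (auto intro!: rec_eval.intros(1,5))
next
  case (Suc n)
  show ?case unfolding triangle_Suc
    by (intro rec_eval.intros(6)[OF Suc] rec_eval_Comp2[OF _ _ rec_eval_add] rec_eval_Succ
        rec_eval_Proj) simp_all
qed

lemma rec_eval_pair:
  "rec_eval f xs m \<Longrightarrow> rec_eval g xs n \<Longrightarrow> rec_eval (rec_pair f g) xs (prod_encode (m, n))"
  unfolding rec_pair_def prod_encode_def prod.case
  by (intro rec_eval_Comp2[OF _ _ rec_eval_add] rec_eval_Comp1[OF _ rec_eval_triangle])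

text \<open>The constant 4 is the tag of \<open>Choice\<close>, and a one-element list is coded as
  \<open>Suc (prod_encode (x, 0))\<close>. \<open>Proj 1\<close> is the code of the preceding
  numeral.\<close>

definition rec_numeral :: recf where
  "rec_numeral = Prim (rec_const (code_trm (numeral_proc 0 0)))
     (rec_pair (rec_const 4) (Comp Succ
       [rec_pair (rec_pair (rec_const (code_prefix (Out (unit_ch 0)))) (Proj 1)) Zero]))"

lemma rec_eval_numeral: "rec_eval rec_numeral [n] (code_trm (numeral_proc 0 n))"
  unfolding rec_numeral_def
proof (induction n)
  case 0
  then show ?case by (intro rec_eval.intros(5) rec_eval_const)
next
  case (Suc n)
  have code: "code_trm (numeral_proc 0 (Suc n)) = prod_encode (4, Suc (prod_encode
      (prod_encode (code_prefix (Out (unit_ch 0)), code_trm (numeral_proc 0 n)), 0)))"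
    by (simp del: code_prefix.simps)
  show ?case unfolding code
    by (intro rec_eval.intros(6)[OF Suc] rec_eval_pair rec_eval_const rec_eval_Succ rec_eval.intros(1)
        rec_eval_Proj) simp_all
qed

text \<open>Maps the code of a process \<open>T\<close> to the code of \<open>T\<close> run on its own code.\<close>

definition rec_self :: recf where
  "rec_self = rec_pair (rec_const 3) (rec_pair (Proj 0)
     (rec_pair (rec_const 2) (rec_pair (rec_const 0) rec_numeral)))"

lemma rec_eval_self:
  "rec_eval rec_self [code_trm T] (code_trm (Par T (input (code_trm T))))"
  unfolding rec_self_def input_def code_trm.simps
  by (intro rec_eval_pair rec_eval_const rec_eval_numeral rec_eval_Proj) simp_all

section \<open>Self-application and undecidability\<close>

lemma process_computing:
  obtains T where "\<And>n. Par T (input n) \<in> Es1"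
    and "\<And>n v. rec_eval g [n] v \<Longrightarrow>
      if v = 0 then \<forall>Q. static_red\<^sup>*\<^sup>* (Par T (input n)) Q \<longrightarrow> \<not> has_barb Q (BOut bell)
      else barb_omega (Par T (input n)) (BOut bell)"
proof -
  \<comment> \<open>Register 0 is the input, register 1 the answer that \<open>verdict\<close>
    tests, and scratch starts at 2.\<close>
  let ?c = "compile g [0] 1 2"
  have "if v = 0 then \<forall>Q. static_red\<^sup>*\<^sup>* (Par (machine ?c) (input n)) Q \<longrightarrow> \<not> has_barb Q (BOut bell)
      else barb_omega (Par (machine ?c) (input n)) (BOut bell)" if "rec_eval g [n] v" for n v
  proof -
    let ?s = "(\<lambda>_. 0)(0 := n)"
    have "exec ?c ?s (?s(1 := v))"
      by (rule exec_computes[OF computes_compile[OF that]]) auto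
    from machine_behaviour[OF this] show ?thesis by simp
  qed
  with static_machine show thesis by (rule that)
qed

lemma barb_omega_imp_barb_1: "barb_omega P e \<Longrightarrow> barb_k 1 P e"
  unfolding barb_omega_def barb_k_def by auto

lemma barb_1_iff: "barb_k 1 P e \<longleftrightarrow> (\<exists>Q. static_red\<^sup>*\<^sup>* P Q \<and> has_barb Q e)"
proof
  assume "\<exists>Q. static_red\<^sup>*\<^sup>* P Q \<and> has_barb Q e"
  then obtain Q where "static_red\<^sup>*\<^sup>* P Q" "has_barb Q e" by blast
  then show "barb_k 1 P e" unfolding barb_k_def by (intro exI[of _ "\<lambda>_. Q"]) auto
qed (auto simp: barb_k_def)

lemma BC_Nil: "BC P [] = {P}"
  by (simp add: BC_def)

text \<open>\<open>T\<close> applies the assumed decider to the instance formed by \<open>T\<close>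
  and its own code. Answer 1 makes the process ring for ever, against \<open>yes\<close>; answer 0
  keeps every reachable state silent, against \<open>no\<close>. Both hypotheses are weak enough to
  fit either problem.\<close>

lemma undecidable_self_application:
  assumes inst: "\<And>P. P \<in> Es1 \<Longrightarrow> inst P \<in> I"
    and code: "\<And>T. rec_eval h [code_trm T] (code (inst (Par T (input (code_trm T)))))"
    and yes: "\<And>P. yes (inst P) \<Longrightarrow> \<not> barb_omega P (BOut bell)"
    and no: "\<And>P. \<not> yes (inst P) \<Longrightarrow> barb_k 1 P (BOut bell)"
  shows "\<not> decidable_problem code I yes"
proof
  assume "decidable_problem code I yes"
  then obtain f where f: "\<And>x. x \<in> I \<Longrightarrow> rec_eval f [code x] (if yes x then 1 else 0)"
    unfolding decidable_problem_def by blast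
  obtain T where T: "\<And>n. Par T (input n) \<in> Es1"
    and beh: "\<And>n v. rec_eval (Comp f [h]) [n] v \<Longrightarrow>
      if v = 0 then \<forall>Q. static_red\<^sup>*\<^sup>* (Par T (input n)) Q \<longrightarrow> \<not> has_barb Q (BOut bell)
      else barb_omega (Par T (input n)) (BOut bell)"
    using process_computing[of "Comp f [h]"] by metis
  let ?P = "Par T (input (code_trm T))"
  have "rec_eval (Comp f [h]) [code_trm T] (if yes (inst ?P) then 1 else 0)"
    by (rule rec_eval_Comp1[OF code f[OF inst[OF T]]])
  from beh[OF this] show False
    using yes[of ?P] no[of ?P, unfolded barb_1_iff] by (cases "yes (inst ?P)") auto
qed

theorem theorem6p3:
  shows "\<not> decidable_problem code_bounded (bounded_instances Es1) bounded_adaptation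
    \<and> \<not> decidable_problem code_eventual (eventual_instances Es1) eventual_adaptation"
proof
  let ?e = "BOut bell"
  \<comment> \<open>The empty list and the barb are the same in every instance, so their code enters
    as a constant.\<close>
  let ?h = "rec_pair rec_self (rec_const (prod_encode (list_encode (map code_trm []), code_barb ?e)))"
  have h: "rec_eval ?h [code_trm T] (code_eventual (Par T (input (code_trm T)), [], ?e))" for T
    unfolding code_eventual.simps by (intro rec_eval_pair rec_eval_self rec_eval_const)
  show "\<not> decidable_problem code_bounded (bounded_instances Es1) bounded_adaptation"
  \<comment> \<open>With \<open>M\<close> empty and \<open>k = 1\<close>, bounded adaptation says
    that no reachable state offers the barb.\<close>
  proof (rule undecidable_self_application[where inst = "\<lambda>P. (P, [], ?e, 1)"])
    show "rec_eval (rec_pair ?h (rec_const 1)) [code_trm T]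
        (code_bounded (Par T (input (code_trm T)), [], ?e, 1))" for T
      unfolding code_bounded.simps by (intro rec_eval_pair h rec_eval_const)
  qed (auto simp: bounded_instances_def BC_Nil dest: barb_omega_imp_barb_1)
  show "\<not> decidable_problem code_eventual (eventual_instances Es1) eventual_adaptation"
  proof (rule undecidable_self_application[where inst = "\<lambda>P. (P, [], ?e)", OF _ h])
  qed (auto simp: eventual_instances_def BC_Nil dest: barb_omega_imp_barb_1)
qed

end
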